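(* Let $f(\lambda):=\sum_{n=0}^\infty\alpha_n\lambda^n$ be a power series with complex coefficients, convergent on the open disk $D(0,R)$, $R>0$, and let $f_a(\lambda):=\sum_{n=0}^\infty|\alpha_n|\lambda^n$. If $H$ is a separable infinite-dimensional complex Hilbert space and $A,B\in\mathcal{B}_1(H)$ are positive operators with $\operatorname{tr}(A)<R^{1/2}$ and $\operatorname{tr}(B)<R^{1/2}$, then $$\left|\operatorname{tr}(f(AB))\right|^2\le \left[f_a(\operatorname{tr}A\,\operatorname{tr}B)\right]^2\le f_a\left((\operatorname{tr}A)^2\right)f_a\left((\operatorname{tr}B)^2\right).$$
   Context: $D(0,R)=\{z\in\mathbb{C}:|z|<R\}$ if $R<\infty$ and $D(0,R)=\mathbb{C}$ if $R=\infty$ (with $R^{1/2}=\infty$ in that case). $\mathcal{B}(H)$ is the algebra of bounded linear operators on $H$; an operator $A$ is positive if $\langle Ax,x\rangle\ge0$ for all $x\in H$. $\mathcal{B}_1(H)$ is the set of trace class operators, i.e. $A\in\mathcal{B}(H)$ with $\sum_{i}\langle|A|e_i,e_i\rangle<\infty$ for an orthonormal basis $\{e_i\}$ of $H$, where $|A|=(A^*A)^{1/2}$; the trace is $\operatorname{tr}(A)=\sum_i\langle Ae_i,e_i\rangle$ for $A\in\mathcal{B}_1(H)$. For an operator $S$, $f(S):=\sum_{n=0}^\infty\alpha_nS^n$ (with $S^0=1_H$, the identity operator).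
   Formalization: The trace of f(AB) is defined only if α_0 = 0 (otherwise f(AB) is α_0·1_H plus a trace class operator); f(AB) is shown to be trace class for α_0 = 0, and for α_0 ≠ 0 the undefined trace is read as 0, so the first inequality is trivial there. *)

theory Defs
  imports "HOL-Analysis.Analysis"
begin

(* The inner product is linear in its first argument.  Positive definiteness of cinner
   is a consequence of the last axiom, and completeness comes from the superclass. *)

class complex_hilbert_space = banach +
  fixes scaleC :: "complex \<Rightarrow> 'a \<Rightarrow> 'a"  (infixr "*\<^sub>C" 75)
    and cinner :: "'a \<Rightarrow> 'a \<Rightarrow> complex"
  assumes scaleC_add_right: "c *\<^sub>C (x + y) = c *\<^sub>C x + c *\<^sub>C y"
    and scaleC_add_left: "(c + d) *\<^sub>C x = c *\<^sub>C x + d *\<^sub>C x"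
    and scaleC_scaleC: "c *\<^sub>C d *\<^sub>C x = (c * d) *\<^sub>C x"
    and scaleC_one: "1 *\<^sub>C x = x"
    and scaleR_scaleC: "r *\<^sub>R x = complex_of_real r *\<^sub>C x"
    and cinner_commute: "cinner x y = cnj (cinner y x)"
    and cinner_add_left: "cinner (x + y) z = cinner x z + cinner y z"
    and cinner_scaleC_left: "cinner (c *\<^sub>C x) y = c * cinner x y"
    and norm_eq_sqrt_cinner: "norm x = sqrt (Re (cinner x x))"

interpretation complex_vector: vector_space "scaleC :: complex \<Rightarrow> 'a \<Rightarrow> 'a::complex_hilbert_space"
  by unfold_locales
    (simp_all add: scaleC_add_right scaleC_add_left scaleC_scaleC scaleC_one)

lemma norm_scaleC: "norm (c *\<^sub>C x) = cmod c * norm (x :: 'a::complex_hilbert_space)"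
proof -
  have "cinner (c *\<^sub>C x) (c *\<^sub>C x) = c * cnj (c * cinner x x)"
    by (metis cinner_commute cinner_scaleC_left)
  also have "\<dots> = complex_of_real ((cmod c)\<^sup>2) * cinner x x"
    using cinner_commute[of x x] by (simp add: complex_norm_square mult_ac flip: of_real_power)
  finally have "Re (cinner (c *\<^sub>C x) (c *\<^sub>C x)) = (cmod c)\<^sup>2 * Re (cinner x x)"
    by simp
  then show ?thesis
    by (simp add: norm_eq_sqrt_cinner real_sqrt_mult)
qed

lemma bounded_linear_scaleC:
  "bounded_linear (scaleC c :: 'a \<Rightarrow> 'a::complex_hilbert_space)"
proof (rule bounded_linear_intro[where K = "cmod c"])
  show "c *\<^sub>C (r *\<^sub>R x) = r *\<^sub>R (c *\<^sub>C x)" for r and x :: 'a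
    by (simp add: scaleR_scaleC scaleC_scaleC mult.commute)
qed (simp_all add: scaleC_add_right norm_scaleC mult.commute)


subsection \<open>Bounded operators\<close>

(* The type 'a =>_L 'a consists of the real-linear bounded operators;
   the bounded operators on the complex space H form the subset below. *)

definition bounded_operators :: "('a::complex_hilbert_space \<Rightarrow>\<^sub>L 'a) set" where
  "bounded_operators = {T. \<forall>c x. blinfun_apply T (c *\<^sub>C x) = c *\<^sub>C blinfun_apply T x}"

definition scaleC_op ::
    "complex \<Rightarrow> ('a::complex_hilbert_space \<Rightarrow>\<^sub>L 'a) \<Rightarrow> ('a \<Rightarrow>\<^sub>L 'a)" where
  "scaleC_op c T = Blinfun (\<lambda>x. c *\<^sub>C blinfun_apply T x)"

lemma blinfun_apply_scaleC_op:
  "blinfun_apply (scaleC_op c T) x = c *\<^sub>C blinfun_apply T x"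
  unfolding scaleC_op_def
  by (simp add: bounded_linear_Blinfun_apply
      bounded_linear_compose[OF bounded_linear_scaleC blinfun.bounded_linear_right])

definition op_power ::
    "('a::complex_hilbert_space \<Rightarrow>\<^sub>L 'a) \<Rightarrow> nat \<Rightarrow> ('a \<Rightarrow>\<^sub>L 'a)" where
  "op_power S n = ((\<lambda>T. S o\<^sub>L T) ^^ n) id_blinfun"

(* The series converges in the operator norm. *)

definition op_series ::
    "(nat \<Rightarrow> complex) \<Rightarrow> ('a::complex_hilbert_space \<Rightarrow>\<^sub>L 'a) \<Rightarrow> ('a \<Rightarrow>\<^sub>L 'a)" where
  "op_series \<alpha> S = (\<Sum>n. scaleC_op (\<alpha> n) (op_power S n))"

definition positive_op :: "('a::complex_hilbert_space \<Rightarrow>\<^sub>L 'a) \<Rightarrow> bool" where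
  "positive_op T \<longleftrightarrow>
     T \<in> bounded_operators \<and> (\<forall>x. cinner (blinfun_apply T x) x \<in> \<real>\<^sub>\<ge>\<^sub>0)"

definition adjoint_op :: "('a::complex_hilbert_space \<Rightarrow>\<^sub>L 'a) \<Rightarrow> ('a \<Rightarrow>\<^sub>L 'a)" where
  "adjoint_op T = (THE S. S \<in> bounded_operators \<and>
     (\<forall>x y. cinner (blinfun_apply T x) y = cinner x (blinfun_apply S y)))"

definition sqrt_op :: "('a::complex_hilbert_space \<Rightarrow>\<^sub>L 'a) \<Rightarrow> ('a \<Rightarrow>\<^sub>L 'a)" where
  "sqrt_op T = (THE P. positive_op P \<and> P o\<^sub>L P = T)"

definition abs_op :: "('a::complex_hilbert_space \<Rightarrow>\<^sub>L 'a) \<Rightarrow> ('a \<Rightarrow>\<^sub>L 'a)" where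
  "abs_op T = sqrt_op (adjoint_op T o\<^sub>L T)"


subsection \<open>Trace class operators and the trace\<close>

definition orthonormal_basis :: "'a::complex_hilbert_space set \<Rightarrow> bool" where
  "orthonormal_basis E \<longleftrightarrow>
     (\<forall>x\<in>E. \<forall>y\<in>E. cinner x y = (if x = y then 1 else 0)) \<and>
     closure (complex_vector.span E) = UNIV"

definition trace_class :: "('a::complex_hilbert_space \<Rightarrow>\<^sub>L 'a) set" where
  "trace_class = {T \<in> bounded_operators.
     \<exists>E. orthonormal_basis E \<and> (\<lambda>e. cinner (blinfun_apply (abs_op T) e) e) summable_on E}"

(* For trace class operators the sum does not depend on the orthonormal basis, so an
   arbitrary one is chosen.  If the sum does not converge, infsum returns 0. *)

definition op_trace :: "('a::complex_hilbert_space \<Rightarrow>\<^sub>L 'a) \<Rightarrow> complex" where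
  "op_trace T =
     (\<Sum>\<^sub>\<infinity>e\<in>(SOME E. orthonormal_basis E). cinner (blinfun_apply T e) e)"


subsection \<open>Scalar power series\<close>

definition abs_series :: "(nat \<Rightarrow> complex) \<Rightarrow> real \<Rightarrow> real" where
  "abs_series \<alpha> x = (\<Sum>n. cmod (\<alpha> n) * x ^ n)"

definition ereal_sqrt :: "ereal \<Rightarrow> ereal" where
  "ereal_sqrt R = (if R = \<infinity> then \<infinity> else ereal (sqrt (real_of_ereal R)))"

end

(* The square roots C of A and D of B are Hilbert-Schmidt operators whose squared Hilbert-Schmidt
   norms are the traces a of A and b of B.  Each power (AB)^n with n > 0 is C V D with
   |V| <= sqrt (a b) (a b)^(n - 1), so the sum over an orthonormal basis of |<(AB)^n e, e>| is at
   most (a b)^n by the Cauchy-Schwarz inequality, and the first estimate follows by summing over n.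
   If alpha_0 is nonzero, the diagonal entries of f(AB) do not tend to 0 and its trace takes the
   junk value 0.  If alpha_0 = 0, then |f(AB) x| <= k |B x|, so operator monotonicity of the square
   root bounds |f(AB)| by k B and f(AB) is trace class.  The last inequality is the Cauchy-Schwarz
   inequality for series. *)
theory Submission
  imports Defs
begin

subsection \<open>The inner product\<close>

text \<open>\<open>adjoint_op\<close>, \<open>sqrt_op\<close> and \<open>abs_op\<close> are definite
  descriptions, so membership in \<open>trace_class\<close> yields nothing until the positive square
  root is known to exist and to be unique. Existence comes from a fixed-point iteration, uniqueness
  from the same operator monotonicity that later controls |f(AB)|. Adjoints are exhibited: positive
  operators are their own, and the adjoint of f(AB) is the series in BA with conjugate coefficients.
  The exponents match for this reason: (AB)^n contains 2n factors C and 2n factors D. One of each is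
  kept at the ends, and summing over the basis costs sqrt (a b) for this pair. The other 2n - 1 of
  each are measured in operator norm, where |C|^2 <= a and |D|^2 <= b. The term n = 0 has no such
  factors, hence the separate treatment of alpha_0.\<close>

lemma cinner_zero_left [simp]: "cinner 0 (y :: 'a::complex_hilbert_space) = 0"
  using cinner_add_left[of 0 0 y] by simp

lemma cinner_add_right: "cinner (x :: 'a::complex_hilbert_space) (y + z) = cinner x y + cinner x z"
  by (metis cinner_add_left cinner_commute complex_cnj_add)

lemma cinner_zero_right [simp]: "cinner (x :: 'a::complex_hilbert_space) 0 = 0"
  by (metis cinner_zero_left cinner_commute complex_cnj_zero)

lemma cinner_minus_left: "cinner (- x :: 'a::complex_hilbert_space) y = - cinner x y"
  using cinner_add_left[of x "- x" y] by (simp add: eq_neg_iff_add_eq_0 add.commute)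

lemma cinner_diff_left: "cinner (x - z :: 'a::complex_hilbert_space) y = cinner x y - cinner z y"
  using cinner_add_left[of x "- z" y] by (simp add: cinner_minus_left)

lemma cinner_diff_right: "cinner (y :: 'a::complex_hilbert_space) (x - z) = cinner y x - cinner y z"
  by (metis cinner_diff_left cinner_commute complex_cnj_diff)

lemma cinner_scaleC_right: "cinner (x :: 'a::complex_hilbert_space) (c *\<^sub>C y) = cnj c * cinner x y"
  by (metis cinner_scaleC_left cinner_commute complex_cnj_mult)

lemma cinner_scaleR_left: "cinner (r *\<^sub>R x :: 'a::complex_hilbert_space) y = of_real r * cinner x y"
  by (simp add: scaleR_scaleC cinner_scaleC_left)

lemma cinner_scaleR_right: "cinner (x :: 'a::complex_hilbert_space) (r *\<^sub>R y) = of_real r * cinner x y"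
  by (simp add: scaleR_scaleC cinner_scaleC_right)

lemma cinner_sum_left:
  "cinner (\<Sum>i\<in>F. f i) (y :: 'a::complex_hilbert_space) = (\<Sum>i\<in>F. cinner (f i) y)"
  by (induction F rule: infinite_finite_induct) (auto simp: cinner_add_left)

lemma cinner_sum_right:
  "cinner (y :: 'a::complex_hilbert_space) (\<Sum>i\<in>F. f i) = (\<Sum>i\<in>F. cinner y (f i))"
  by (induction F rule: infinite_finite_induct) (auto simp: cinner_add_right)

lemma cinner_self: "cinner x x = of_real ((norm (x :: 'a::complex_hilbert_space))\<^sup>2)"
proof -
  have "Re (cinner x x) = (norm x)\<^sup>2"
    using norm_eq_sqrt_cinner[of x] norm_ge_zero[of x]
    by (metis real_sqrt_ge_0_iff real_sqrt_pow2)
  moreover have "Im (cinner x x) = 0"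
    using cinner_commute[of x x] by (metis Reals_cnj_iff complex_is_Real_iff)
  ultimately show ?thesis
    by (simp add: complex_eq_iff)
qed

lemma Re_cinner_commute: "Re (cinner x y) = Re (cinner y (x :: 'a::complex_hilbert_space))"
  using cinner_commute[of x y] by simp

lemma cinner_eqI:
  fixes x y :: "'a::complex_hilbert_space"
  assumes "\<And>z. cinner x z = cinner y z"
  shows "x = y"
  using assms[of "x - y"] cinner_self[of "x - y"] by (simp add: cinner_diff_left)

subsection \<open>Bounded and positive operators\<close>

lemma bounded_operatorsD:
  "T \<in> bounded_operators \<Longrightarrow> blinfun_apply T (c *\<^sub>C x) = c *\<^sub>C blinfun_apply T x"
  by (simp add: bounded_operators_def)

lemma bounded_operators_id: "id_blinfun \<in> bounded_operators"
  by (simp add: bounded_operators_def)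

lemma bounded_operators_add:
  "S \<in> bounded_operators \<Longrightarrow> T \<in> bounded_operators \<Longrightarrow> S + T \<in> bounded_operators"
  by (simp add: bounded_operators_def blinfun.add_left scaleC_add_right)

lemma bounded_operators_diff:
  "S \<in> bounded_operators \<Longrightarrow> T \<in> bounded_operators \<Longrightarrow> S - T \<in> bounded_operators"
  by (simp add: bounded_operators_def blinfun.diff_left complex_vector.scale_right_diff_distrib)

lemma bounded_operators_scaleR:
  "T \<in> bounded_operators \<Longrightarrow> r *\<^sub>R T \<in> bounded_operators"
  by (simp add: bounded_operators_def blinfun.scaleR_left scaleR_scaleC scaleC_scaleC mult.commute)

lemma bounded_operators_compose:
  "S \<in> bounded_operators \<Longrightarrow> T \<in> bounded_operators \<Longrightarrow> S o\<^sub>L T \<in> bounded_operators"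
  by (simp add: bounded_operators_def)

lemmas bounded_operators_intros = bounded_operators_id bounded_operators_add
  bounded_operators_diff bounded_operators_scaleR bounded_operators_compose

text \<open>A relation in place of the function \<open>adjoint_op\<close>: partners are exhibited
  explicitly, and the relation is preserved by sums, products and norm limits.\<close>

definition adjoint_pair ::
    "('a::complex_hilbert_space \<Rightarrow>\<^sub>L 'a) \<Rightarrow> ('a \<Rightarrow>\<^sub>L 'a) \<Rightarrow> bool" where
  "adjoint_pair S T \<longleftrightarrow>
     (\<forall>x y. cinner (blinfun_apply S x) y = cinner x (blinfun_apply T y))"

lemma adjoint_pairD: "adjoint_pair S T \<Longrightarrow> cinner (blinfun_apply S x) y = cinner x (blinfun_apply T y)"
  by (simp add: adjoint_pair_def)

lemma adjoint_pair_id: "adjoint_pair id_blinfun id_blinfun"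
  by (simp add: adjoint_pair_def)

lemma adjoint_pair_add: "adjoint_pair S S' \<Longrightarrow> adjoint_pair T T' \<Longrightarrow> adjoint_pair (S + T) (S' + T')"
  by (simp add: adjoint_pair_def blinfun.add_left cinner_add_left cinner_add_right)

lemma adjoint_pair_diff: "adjoint_pair S S' \<Longrightarrow> adjoint_pair T T' \<Longrightarrow> adjoint_pair (S - T) (S' - T')"
  by (simp add: adjoint_pair_def blinfun.diff_left cinner_diff_left cinner_diff_right)

lemma adjoint_pair_scaleR: "adjoint_pair S S' \<Longrightarrow> adjoint_pair (r *\<^sub>R S) (r *\<^sub>R S')"
  by (simp add: adjoint_pair_def blinfun.scaleR_left cinner_scaleR_left cinner_scaleR_right)

lemma adjoint_pair_compose:
  "adjoint_pair S S' \<Longrightarrow> adjoint_pair T T' \<Longrightarrow> adjoint_pair (S o\<^sub>L T) (T' o\<^sub>L S')"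
  by (simp add: adjoint_pair_def)

lemmas adjoint_pair_intros = adjoint_pair_id adjoint_pair_add adjoint_pair_diff
  adjoint_pair_scaleR adjoint_pair_compose

text \<open>Evaluates the definite description from an explicit partner; uniqueness holds because a
  vector is determined by its inner products.\<close>

lemma adjoint_op_eqI:
  assumes "S \<in> bounded_operators" "adjoint_pair T S"
  shows "adjoint_op T = S"
  unfolding adjoint_op_def
proof (rule the_equality)
  fix S' assume "S' \<in> bounded_operators \<and> (\<forall>x y. cinner (blinfun_apply T x) y = cinner x (blinfun_apply S' y))"
  then have "cinner (S' y) x = cinner (S y) x" for x y
    using assms(2) by (metis adjoint_pair_def cinner_commute)
  then show "S' = S"
    by (intro blinfun_eqI cinner_eqI)
qed (use assms in \<open>auto simp: adjoint_pair_def\<close>)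

(* Polarization: the form is real at x + y and at x + i y. *)
lemma positive_op_adjoint_pair:
  assumes "positive_op T"
  shows "adjoint_pair T T"
  unfolding adjoint_pair_def
proof (intro allI)
  fix x y
  have T: "T \<in> bounded_operators" and real: "\<And>x. Im (cinner (T x) x) = 0"
    using assms by (auto simp: positive_op_def complex_nonneg_Reals_iff)
  have 1: "Im (cinner (T x) y) + Im (cinner (T y) x) = 0"
    using real[of "x + y"] real[of x] real[of y]
    by (simp add: blinfun.add_right cinner_add_left cinner_add_right)
  have 2: "Re (cinner (T x) y) = Re (cinner (T y) x)"
    using real[of "x + \<i> *\<^sub>C y"] real[of x] real[of y]
    by (simp add: blinfun.add_right bounded_operatorsD[OF T] cinner_add_left cinner_add_right
        cinner_scaleC_left cinner_scaleC_right)
  have "cinner (T x) y = cnj (cinner (T y) x)"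
    using 1 2 by (simp add: complex_eq_iff)
  then show "cinner (T x) y = cinner x (T y)"
    by (metis cinner_commute)
qed

lemma positive_op_iff:
  "positive_op T \<longleftrightarrow>
    T \<in> bounded_operators \<and> adjoint_pair T T \<and> (\<forall>x. 0 \<le> Re (cinner (blinfun_apply T x) x))"
proof
  show "positive_op T" if "T \<in> bounded_operators \<and> adjoint_pair T T \<and> (\<forall>x. 0 \<le> Re (cinner (T x) x))"
  proof -
    have "cnj (cinner (T x) x) = cinner (T x) x" for x
      using that by (metis adjoint_pair_def cinner_commute)
    then have "Im (cinner (T x) x) = 0" for x
      by (metis Reals_cnj_iff complex_is_Real_iff)
    then show ?thesis
      using that by (auto simp: positive_op_def complex_nonneg_Reals_iff)
  qed
qed (use positive_op_adjoint_pair in \<open>auto simp: positive_op_def complex_nonneg_Reals_iff\<close>)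

lemma positive_opD:
  assumes "positive_op T"
  shows "T \<in> bounded_operators" "adjoint_pair T T" "0 \<le> Re (cinner (blinfun_apply T x) x)"
  using assms by (auto simp: positive_op_iff)

lemma positive_op_Re:
  assumes "positive_op T"
  shows "cinner (blinfun_apply T x) x = of_real (Re (cinner (blinfun_apply T x) x))"
  using assms by (simp add: positive_op_def complex_nonneg_Reals_iff complex_eq_iff)

lemma positive_op_id: "positive_op id_blinfun"
  by (auto simp: positive_op_iff bounded_operators_id adjoint_pair_id cinner_self)

lemma positive_op_scaleR: "positive_op S \<Longrightarrow> 0 \<le> r \<Longrightarrow> positive_op (r *\<^sub>R S)"
  by (auto simp: positive_op_iff bounded_operators_intros adjoint_pair_intros
      blinfun.scaleR_left cinner_scaleR_left)

text \<open>Discriminant argument for a form that may be degenerate. Evaluating it at x - t s y with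
  s = <P x, y> removes the phase of s and leaves a nonnegative real polynomial in t, which t = 1 / q
  minimizes when q is nonzero.\<close>

lemma positive_op_Cauchy_Schwarz:
  assumes P: "positive_op P"
  shows "(cmod (cinner (blinfun_apply P x) y))\<^sup>2
    \<le> Re (cinner (blinfun_apply P x) x) * Re (cinner (blinfun_apply P y) y)"
proof -
  define s where "s = cinner (P x) y"
  define p where "p = Re (cinner (P x) x)"
  define q where "q = Re (cinner (P y) y)"
  have yx: "cinner (P y) x = cnj s"
    using positive_opD(2)[OF P] unfolding s_def by (metis adjoint_pair_def cinner_commute)
  have pq: "p \<ge> 0" "q \<ge> 0"
    using positive_opD(3)[OF P] by (auto simp: p_def q_def)
  have quad: "0 \<le> p - 2 * t * (cmod s)\<^sup>2 + t\<^sup>2 * (cmod s)\<^sup>2 * q" for t :: real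
  proof -
    define c where "c = - of_real t * s"
    have Py: "Im (cinner (P y) y) = 0"
      using positive_op_Re[OF P, of y] by (metis Im_complex_of_real)
    have "0 \<le> Re (cinner (P (x + c *\<^sub>C y)) (x + c *\<^sub>C y))"
      by (rule positive_opD(3)[OF P])
    also have "\<dots> = p + Re (cnj c * s) + Re (c * cnj s) + Re (c * cnj c * cinner (P y) y)"
      by (simp add: blinfun.add_right bounded_operatorsD[OF positive_opD(1)[OF P]] cinner_add_left
        cinner_add_right cinner_scaleC_left cinner_scaleC_right yx s_def p_def algebra_simps)
    also have "\<dots> = p - 2 * t * (cmod s)\<^sup>2 + t\<^sup>2 * (cmod s)\<^sup>2 * q"
      using Py by (simp add: c_def q_def cmod_power2) (simp add: power2_eq_square algebra_simps)
    finally show ?thesis .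
  qed
  have "(cmod s)\<^sup>2 \<le> p * q"
  proof (cases "q = 0")
    case True
    show ?thesis
    proof (cases "s = 0")
      case False
      \<comment> \<open>With q = 0 the polynomial is affine in t, and this t would give it the value
        p - (p + 1) = -1.\<close>
      then show ?thesis
        using quad[of "(p + 1) / (2 * (cmod s)\<^sup>2)"] True by simp
    qed (use True in simp)
  next
    case False
    then show ?thesis
      using quad[of "1 / q"] pq by (simp add: field_simps power2_eq_square)
  qed
  then show ?thesis
    by (simp add: s_def p_def q_def)
qed

lemma cinner_Cauchy_Schwarz: "cmod (cinner x y) \<le> norm x * norm (y :: 'a::complex_hilbert_space)"
proof -
  have "(cmod (cinner x y))\<^sup>2 \<le> (norm x * norm y)\<^sup>2"
    using positive_op_Cauchy_Schwarz[OF positive_op_id, of x y]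
    by (simp add: cinner_self power_mult_distrib)
  then show ?thesis
    by (rule power2_le_imp_le) simp
qed

lemma bounded_linear_cinner_left: "bounded_linear (\<lambda>x. cinner x (y :: 'a::complex_hilbert_space))"
  by (rule bounded_linear_intro[where K = "norm y"])
    (auto simp: cinner_add_left cinner_scaleR_left scaleR_conv_of_real cinner_Cauchy_Schwarz)

lemma bounded_linear_cinner_right: "bounded_linear (\<lambda>x. cinner (y :: 'a::complex_hilbert_space) x)"
  by (rule bounded_linear_intro[where K = "norm y"])
    (auto simp: cinner_add_right cinner_scaleR_right scaleR_conv_of_real cinner_Cauchy_Schwarz mult.commute[of _ "norm y"])

lemma Re_cinner_le: "Re (cinner x y) \<le> norm x * norm (y :: 'a::complex_hilbert_space)"
  using complex_Re_le_cmod cinner_Cauchy_Schwarz order_trans by blast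

text \<open>Cauchy-Schwarz for the form of P at x and P x gives |P x|^4 <= <P x, x> |P| |P x|^2. The
  purpose is that a small value of the quadratic form forces P x itself to be small.\<close>

lemma positive_op_norm_square_le:
  assumes P: "positive_op P"
  shows "(norm (blinfun_apply P x))\<^sup>2 \<le> norm P * Re (cinner (blinfun_apply P x) x)"
proof -
  define n where "n = (norm (P x))\<^sup>2"
  have "n\<^sup>2 \<le> Re (cinner (P x) x) * Re (cinner (P (P x)) (P x))"
    using positive_op_Cauchy_Schwarz[OF P, of x "P x"] by (simp add: cinner_self n_def norm_power)
  also have "\<dots> \<le> Re (cinner (P x) x) * (norm P * n)"
  proof (rule mult_left_mono)
    have "Re (cinner (P (P x)) (P x)) \<le> norm (P (P x)) * norm (P x)"
      by (rule Re_cinner_le)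
    also have "\<dots> \<le> norm P * norm (P x) * norm (P x)"
      by (intro mult_right_mono norm_blinfun) auto
    finally show "Re (cinner (P (P x)) (P x)) \<le> norm P * n"
      by (simp add: n_def power2_eq_square)
  qed (use positive_opD(3)[OF P] in simp)
  finally have "n * n \<le> norm P * Re (cinner (P x) x) * n"
    by (simp add: power2_eq_square mult_ac)
  show ?thesis
  proof (cases "P x = 0")
    case False
    then have "n > 0"
      by (simp add: n_def)
    with \<open>n * n \<le> _\<close> show ?thesis
      unfolding n_def[symmetric] by simp
  qed simp
qed

subsection \<open>Square roots and absolute values\<close>

lemma selfadjoint_compose_self:
  assumes "adjoint_pair P P"
  shows "Re (cinner (blinfun_apply (P o\<^sub>L P) x) x) = (norm (blinfun_apply P x))\<^sup>2"
  using adjoint_pairD[OF assms, of "P x" x] by (simp add: cinner_self)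

(* Operator monotonicity of the square root: a vector almost minimizing the quadratic form of
   Q - P is almost an eigenvector of Q - P, with an eigenvalue m.  The real part of
   <(Q - P) x, (Q + P) x>, which is nonnegative by hypothesis, then almost equals
   m <(Q + P) x, x>, which is at most - m^2 if m is negative. *)
lemma positive_op_le_of_norm_le:
  fixes P Q :: "'a::complex_hilbert_space \<Rightarrow>\<^sub>L 'a"
  assumes P: "positive_op P" and Q: "positive_op Q"
    and le: "\<And>x. norm (blinfun_apply P x) \<le> norm (blinfun_apply Q x)"
  shows "Re (cinner (blinfun_apply P x) x) \<le> Re (cinner (blinfun_apply Q x) x)"
proof (rule ccontr)
  assume contra: "\<not> ?thesis"
  define D where "D = Q - P"
  define d where "d = (\<lambda>x. Re (cinner (D x) x))"
  define m where "m = Inf (d ` {x. norm x = 1})"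
  have d_eq: "d x = Re (cinner (Q x) x) - Re (cinner (P x) x)" for x
    by (simp add: d_def D_def blinfun.diff_left cinner_diff_left)
  have neg: "d x < 0"
    using contra by (simp add: d_eq)
  then have "x \<noteq> 0"
    by (auto simp: d_def)
  have d_scale: "d y = (norm y)\<^sup>2 * d (inverse (norm y) *\<^sub>R y)" if "y \<noteq> 0" for y
    using that by (simp add: d_def blinfun.scaleR_right cinner_scaleR_left cinner_scaleR_right
        power2_eq_square field_simps)
  have bdd: "bdd_below (d ` {x. norm x = 1})"
  proof (rule bdd_belowI2)
    fix y :: 'a assume "y \<in> {x. norm x = 1}"
    then have "- d y \<le> norm (D y)"
      using Re_cinner_le[of "- D y" y] by (simp add: d_def cinner_minus_left)
    then show "- norm D \<le> d y"
      using norm_blinfun[of D y] \<open>y \<in> _\<close> by simp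
  qed
  have m_le: "m \<le> d y" if "norm y = 1" for y
    unfolding m_def using bdd that by (intro cINF_lower) auto
  have unit: "norm (inverse (norm y) *\<^sub>R y) = 1" if "y \<noteq> 0" for y :: 'a
    using that by simp
  have m_neg: "m < 0"
    using m_le[OF unit[OF \<open>x \<noteq> 0\<close>]] d_scale[OF \<open>x \<noteq> 0\<close>] neg \<open>x \<noteq> 0\<close>
    by (smt (verit) mult_nonneg_nonneg zero_le_power2)
  \<comment> \<open>Subtracting the infimum makes N positive, so
    \<open>positive_op_norm_square_le\<close> turns "d y is close to m" into "N y is close to
    0".\<close>
  define N where "N = D - m *\<^sub>R id_blinfun"
  define S where "S = Q + P"
  have N_eq: "Re (cinner (N y) y) = d y - m * (norm y)\<^sup>2" for y
    by (simp add: N_def d_def blinfun.diff_left blinfun.scaleR_left cinner_diff_left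
        cinner_scaleR_left cinner_self)
  have N: "positive_op N"
    unfolding positive_op_iff
  proof (intro conjI allI)
    fix y
    show "0 \<le> Re (cinner (N y) y)"
    proof (cases "y = 0")
      case False
      then have "m * (norm y)\<^sup>2 \<le> (norm y)\<^sup>2 * d (inverse (norm y) *\<^sub>R y)"
        using m_le[OF unit[OF False]] by (simp add: mult.commute[of m] mult_left_mono)
      then show ?thesis
        using d_scale[OF False] by (simp add: N_eq)
    qed simp
  qed (auto simp: N_def D_def intro!: bounded_operators_intros adjoint_pair_intros
      positive_opD[OF P] positive_opD[OF Q])
  have key: "m * (m + \<epsilon>) - sqrt (norm N * \<epsilon>) * norm S \<le> 0" if "\<epsilon> > 0" for \<epsilon>
  proof -
    have "d ` {x. norm x = 1} \<noteq> {}" (is "?V \<noteq> _")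
      using unit[OF \<open>x \<noteq> 0\<close>] by blast
    moreover have "Inf ?V < m + \<epsilon>"
      using that by (simp add: m_def)
    ultimately obtain v where "v \<in> ?V" "v < m + \<epsilon>"
      by (rule cInf_lessD[THEN bexE])
    then obtain y where y: "norm y = 1" "d y < m + \<epsilon>"
      by blast
    have "(norm (N y))\<^sup>2 \<le> norm N * (d y - m)"
      using positive_op_norm_square_le[OF N, of y] y by (simp add: N_eq)
    also have "\<dots> \<le> norm N * \<epsilon>"
      using y by (intro mult_left_mono) auto
    finally have Ny: "norm (N y) \<le> sqrt (norm N * \<epsilon>)"
      by (rule real_le_rsqrt)
    have "0 \<le> (norm (Q y))\<^sup>2 - (norm (P y))\<^sup>2"
      using le[of y] by simp
    \<comment> \<open>P and Q need not commute, but the two cross terms have equal real parts and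
      cancel.\<close>
    also have "\<dots> = Re (cinner (D y) (S y))"
      using Re_cinner_commute[of "Q y" "P y"]
      by (simp add: D_def S_def blinfun.diff_left blinfun.add_left cinner_diff_left
          cinner_add_right cinner_self)
    also have "\<dots> = Re (cinner (N y) (S y)) + m * Re (cinner (S y) y)"
      by (simp add: N_def blinfun.diff_left blinfun.scaleR_left cinner_diff_left
          cinner_scaleR_left Re_cinner_commute[of y])
    also have "Re (cinner (N y) (S y)) \<le> sqrt (norm N * \<epsilon>) * norm S"
    proof -
      have "Re (cinner (N y) (S y)) \<le> norm (N y) * norm (S y)"
        by (rule Re_cinner_le)
      also have "\<dots> \<le> sqrt (norm N * \<epsilon>) * norm S"
        using Ny norm_blinfun[of S y] y that by (intro mult_mono) auto
      finally show ?thesis .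
    qed
    finally have *: "- (m * Re (cinner (S y) y)) \<le> sqrt (norm N * \<epsilon>) * norm S"
      by simp
    \<comment> \<open>S + D is twice the positive operator Q, so <S y, y> is at least - d y.\<close>
    have "- (m + \<epsilon>) \<le> Re (cinner (S y) y)"
      using y(2) positive_opD(3)[OF Q, of y]
      by (simp add: d_eq S_def blinfun.add_left cinner_add_left)
    then have "- m * - (m + \<epsilon>) \<le> - m * Re (cinner (S y) y)"
      using m_neg by (intro mult_left_mono) auto
    then show ?thesis
      using * by (simp add: algebra_simps)
  qed
  \<comment> \<open>Letting epsilon tend to 0 leaves m^2 <= 0, against m < 0.\<close>
  have "((\<lambda>\<epsilon>. m * (m + \<epsilon>) - sqrt (norm N * \<epsilon>) * norm S) \<longlongrightarrow>
      m * (m + 0) - sqrt (norm N * 0) * norm S) (at_right 0)"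
    by (intro tendsto_intros)
  then have "m * (m + 0) - sqrt (norm N * 0) * norm S \<le> 0"
    by (rule tendsto_upperbound)
      (use key in \<open>simp_all add: eventually_mono[OF eventually_at_right_less[of 0]]\<close>)
  then show False
    using m_neg by (simp add: mult_le_0_iff)
qed

text \<open>Equal squares give |P y| = |Q y| for all y, and monotonicity in both directions then
  gives equal quadratic forms. Thus P - Q is a positive operator with zero form, and
  \<open>positive_op_norm_square_le\<close> annihilates it.\<close>

lemma positive_op_eqI:
  assumes "positive_op P" "positive_op Q" and eq: "P o\<^sub>L P = Q o\<^sub>L Q"
  shows "P = Q"
proof (rule blinfun_eqI)
  fix x
  have "(norm (P y))\<^sup>2 = (norm (Q y))\<^sup>2" for y
    using selfadjoint_compose_self[OF positive_opD(2)[OF assms(1)], of y]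
      selfadjoint_compose_self[OF positive_opD(2)[OF assms(2)], of y] eq by simp
  then have n: "norm (P y) = norm (Q y)" for y
    by simp
  have 1: "Re (cinner (P y) y) = Re (cinner (Q y) y)" for y
    using positive_op_le_of_norm_le[OF assms(1,2)] positive_op_le_of_norm_le[OF assms(2,1)] n
    by (simp add: order_antisym)
  have "positive_op (P - Q)"
    using assms 1 by (auto simp: positive_op_iff blinfun.diff_left cinner_diff_left
        intro!: bounded_operators_intros adjoint_pair_intros)
  from positive_op_norm_square_le[OF this, of x] show "P x = Q x"
    by (simp add: blinfun.diff_left cinner_diff_left 1)
qed

lemma sqrt_op_eqI: "positive_op P \<Longrightarrow> P o\<^sub>L P = T \<Longrightarrow> sqrt_op T = P"
  unfolding sqrt_op_def by (rule the_equality) (auto intro: positive_op_eqI)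

lemma abs_op_positive:
  assumes "positive_op A"
  shows "abs_op A = A"
  unfolding abs_op_def
  using adjoint_op_eqI[OF positive_opD(1,2)[OF assms]] sqrt_op_eqI[OF assms] by simp

section \<open>Existence of positive square roots and absolute values\<close>

lemmas blinfun_compose_diff_left = bounded_bilinear.diff_left[OF bounded_bilinear_blinfun_compose]
lemmas blinfun_compose_diff_right = bounded_bilinear.diff_right[OF bounded_bilinear_blinfun_compose]
lemmas blinfun_compose_scaleR_left = bounded_bilinear.scaleR_left[OF bounded_bilinear_blinfun_compose]
lemmas blinfun_compose_scaleR_right = bounded_bilinear.scaleR_right[OF bounded_bilinear_blinfun_compose]

lemma blinfun_compose_assoc: "(S o\<^sub>L T) o\<^sub>L U = S o\<^sub>L (T o\<^sub>L U)"
  by (rule blinfun_eqI) simp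

lemma blinfun_compose_id [simp]: "id_blinfun o\<^sub>L T = T" "T o\<^sub>L id_blinfun = T"
  by (auto intro!: blinfun_eqI)

lemma tendsto_blinfun_apply:
  "(f \<longlongrightarrow> T) F \<Longrightarrow> ((\<lambda>k. blinfun_apply (f k) x) \<longlongrightarrow> blinfun_apply T x) F"
  by (rule bounded_linear.tendsto[OF blinfun.bounded_linear_left])

lemma bounded_operators_limit:
  assumes "\<And>k. Y k \<in> bounded_operators" "Y \<longlonglongrightarrow> Z"
  shows "Z \<in> bounded_operators"
  unfolding bounded_operators_def
proof (intro CollectI allI)
  fix c x
  have "(\<lambda>k. Y k (c *\<^sub>C x)) \<longlonglongrightarrow> c *\<^sub>C Z x"
    using bounded_linear.tendsto[OF bounded_linear_scaleC tendsto_blinfun_apply[OF assms(2)]]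
    by (simp add: bounded_operatorsD[OF assms(1)])
  then show "Z (c *\<^sub>C x) = c *\<^sub>C Z x"
    using tendsto_blinfun_apply[OF assms(2)] LIMSEQ_unique by blast
qed

lemma adjoint_pair_limit:
  assumes "\<And>k. adjoint_pair (Y k) (Y' k)" "Y \<longlonglongrightarrow> Z" "Y' \<longlonglongrightarrow> Z'"
  shows "adjoint_pair Z Z'"
  unfolding adjoint_pair_def
proof (intro allI)
  fix x y
  have "(\<lambda>k. cinner (Y k x) y) \<longlonglongrightarrow> cinner (Z x) y"
    by (rule bounded_linear.tendsto[OF bounded_linear_cinner_left tendsto_blinfun_apply[OF assms(2)]])
  moreover have "(\<lambda>k. cinner x (Y' k y)) \<longlonglongrightarrow> cinner x (Z' y)"
    by (rule bounded_linear.tendsto[OF bounded_linear_cinner_right tendsto_blinfun_apply[OF assms(3)]])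
  ultimately show "cinner (Z x) y = cinner x (Z' y)"
    using LIMSEQ_unique by (simp add: adjoint_pairD[OF assms(1)])
qed

text \<open>The difference of squares without commutativity; it bounds the increments of the
  iteration below.\<close>

lemma blinfun_compose_square_diff:
  "(S o\<^sub>L S) - (T o\<^sub>L T) = (S o\<^sub>L (S - T)) + ((S - T) o\<^sub>L T)"
  by (simp add: blinfun_compose_diff_left blinfun_compose_diff_right)

(* The scalar iteration t \<mapsto> (1 + t^2) / 2 from 0 increases to 1 and majorizes the increments of
   Y \<mapsto> (X + Y^2) / 2, whose fixed point Y satisfies (1 - Y)^2 = 1 - X. *)
lemma positive_op_sqrt_exists_contraction:
  fixes X :: "'a::complex_hilbert_space \<Rightarrow>\<^sub>L 'a"
  assumes X: "X \<in> bounded_operators" "adjoint_pair X X" "norm X \<le> 1"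
  shows "\<exists>P. positive_op P \<and> P o\<^sub>L P = id_blinfun - X"
proof -
  define Y where "Y = rec_nat 0 (\<lambda>_ T. (1/2) *\<^sub>R (X + (T o\<^sub>L T)))"
  define t where "t = rec_nat 0 (\<lambda>_ t::real. (1 + t\<^sup>2) / 2)"
  have Y0: "Y 0 = 0" and YS: "Y (Suc k) = (1/2) *\<^sub>R (X + (Y k o\<^sub>L Y k))" for k
    by (auto simp: Y_def)
  have t0: "t 0 = 0" and tS: "t (Suc k) = (1 + (t k)\<^sup>2) / 2" for k
    by (auto simp: t_def)
  have t: "0 \<le> t k \<and> t k \<le> 1" for k
    by (induction k) (auto simp: t0 tS power_le_one)
  have "t k \<le> t (Suc k)" for k
    using zero_le_power2[of "t k - 1"] by (simp add: tS power2_eq_square algebra_simps)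
  then have "incseq t"
    by (rule incseq_SucI)
  then obtain l where l: "t \<longlonglongrightarrow> l"
    using incseq_convergent[of t 1] t by blast
  have Yt: "norm (Y k) \<le> t k" for k
  proof (induction k)
    case (Suc k)
    have "norm (X + (Y k o\<^sub>L Y k)) \<le> norm X + norm (Y k o\<^sub>L Y k)"
      by (rule norm_triangle_ineq)
    also have "norm (Y k o\<^sub>L Y k) \<le> norm (Y k) * norm (Y k)"
      by (rule norm_blinfun_compose)
    also have "\<dots> \<le> t k * t k"
      using Suc t by (intro mult_mono) auto
    finally show ?case
      using X(3) by (simp add: YS tS power2_eq_square)
  qed (simp add: Y0 t0)
  have incr: "norm (Y (Suc k) - Y k) \<le> t (Suc k) - t k" for k
  proof (induction k)
    case 0
    then show ?case
      using X(3) by (simp add: YS tS Y0 t0)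
  next
    case (Suc k)
    have "Y (Suc (Suc k)) - Y (Suc k) = (1/2) *\<^sub>R ((Y (Suc k) o\<^sub>L Y (Suc k)) - (Y k o\<^sub>L Y k))"
      unfolding YS[of "Suc k"] by (subst (3) YS) (simp add: algebra_simps)
    then have "norm (Y (Suc (Suc k)) - Y (Suc k))
        = norm ((Y (Suc k) o\<^sub>L (Y (Suc k) - Y k)) + ((Y (Suc k) - Y k) o\<^sub>L Y k)) / 2"
      by (simp add: blinfun_compose_square_diff)
    also have "\<dots> \<le> (norm (Y (Suc k)) * norm (Y (Suc k) - Y k)
        + norm (Y (Suc k) - Y k) * norm (Y k)) / 2"
      by (intro divide_right_mono norm_triangle_mono norm_blinfun_compose) auto
    also have "\<dots> \<le> (t (Suc k) * (t (Suc k) - t k) + (t (Suc k) - t k) * t k) / 2"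
      using Suc Yt t \<open>\<And>k. t k \<le> t (Suc k)\<close>
      by (intro divide_right_mono add_mono mult_mono) auto
    also have "\<dots> = t (Suc (Suc k)) - t (Suc k)"
    proof -
      have "(t k)\<^sup>2 = 2 * t (Suc k) - 1"
        by (simp add: tS field_simps)
      then show ?thesis
        unfolding tS[of "Suc k"] by (simp add: power2_eq_square field_simps)
    qed
    finally show ?case .
  qed
  \<comment> \<open>The scalar majorants telescope along the convergent sequence t.\<close>
  have "summable (\<lambda>k. Y (Suc k) - Y k)"
    by (rule summable_comparison_test'[OF telescope_summable[OF l] incr])
  then have "convergent (\<lambda>n. \<Sum>k<n. Y (Suc k) - Y k)"
    by (simp add: summable_iff_convergent)
  then obtain Z where Z: "Y \<longlonglongrightarrow> Z"
    by (auto simp: sum_lessThan_telescope Y0 convergent_def)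
  have "(\<lambda>k. (1/2) *\<^sub>R (X + (Y k o\<^sub>L Y k))) \<longlonglongrightarrow> (1/2) *\<^sub>R (X + (Z o\<^sub>L Z))"
    by (intro tendsto_intros bounded_bilinear.tendsto[OF bounded_bilinear_blinfun_compose] Z)
  then have fix_Z: "Z = (1/2) *\<^sub>R (X + (Z o\<^sub>L Z))"
    by (rule LIMSEQ_unique[OF LIMSEQ_Suc[OF Z, unfolded YS]])
  have Y_op: "Y k \<in> bounded_operators \<and> adjoint_pair (Y k) (Y k)" for k
  proof (induction k)
    case 0
    then show ?case
      by (simp add: Y0 bounded_operators_def adjoint_pair_def)
  qed (auto simp: YS intro!: bounded_operators_intros adjoint_pair_intros X)
  have "norm Z \<le> 1"
    by (rule LIMSEQ_le_const2[OF tendsto_norm[OF Z]]) (use Yt t order_trans in blast)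
  have "positive_op (id_blinfun - Z)"
    unfolding positive_op_iff
  proof (intro conjI allI)
    fix x
    have "Re (cinner (Z x) x) \<le> norm (Z x) * norm x"
      by (rule Re_cinner_le)
    also have "\<dots> \<le> 1 * norm x * norm x"
      by (intro mult_right_mono order_trans[OF norm_blinfun] \<open>norm Z \<le> 1\<close> norm_ge_zero)
    finally show "0 \<le> Re (cinner ((id_blinfun - Z) x) x)"
      by (simp add: blinfun.diff_left cinner_diff_left cinner_self power2_eq_square)
  next
    have "Z \<in> bounded_operators" "adjoint_pair Z Z"
      using bounded_operators_limit[OF _ Z] adjoint_pair_limit[OF _ Z Z] Y_op by blast+
    then show "id_blinfun - Z \<in> bounded_operators"
        "adjoint_pair (id_blinfun - Z) (id_blinfun - Z)"
      by (auto intro!: bounded_operators_intros adjoint_pair_intros)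
  qed
  moreover have "(id_blinfun - Z) o\<^sub>L (id_blinfun - Z) = id_blinfun - X"
  proof -
    have "2 *\<^sub>R Z = X + (Z o\<^sub>L Z)"
      by (subst fix_Z) simp
    then show ?thesis
      by (simp add: blinfun_compose_diff_left blinfun_compose_diff_right scaleR_2 algebra_simps)
  qed
  ultimately show ?thesis
    by blast
qed

text \<open>Dividing T by its norm n places X = 1 - T / n between 0 and 1 as a form, and
  Cauchy-Schwarz at x and X x upgrades this to |X| <= 1. The iteration then gives a root of T / n,
  which is scaled back by sqrt n.\<close>

lemma positive_op_sqrt_exists:
  fixes T :: "'a::complex_hilbert_space \<Rightarrow>\<^sub>L 'a"
  assumes T: "positive_op T"
  obtains P where "positive_op P" "P o\<^sub>L P = T"
proof (cases "T = 0")
  case True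
  then show ?thesis
    using that[of 0] by (auto simp: positive_op_def bounded_operators_def intro!: blinfun_eqI)
next
  case False
  define n where "n = norm T"
  have n: "n > 0"
    using False by (simp add: n_def)
  define X where "X = id_blinfun - (1 / n) *\<^sub>R T"
  have X: "X \<in> bounded_operators" "adjoint_pair X X"
    unfolding X_def
    by (auto intro!: bounded_operators_intros adjoint_pair_intros positive_opD[OF T])
  have X_eq: "Re (cinner (X x) x) = (norm x)\<^sup>2 - Re (cinner (T x) x) / n" for x
    by (simp add: X_def blinfun.diff_left blinfun.scaleR_left cinner_diff_left
        cinner_scaleR_left cinner_self)
  have X_le: "Re (cinner (X x) x) \<le> (norm x)\<^sup>2" for x
    using positive_opD(3)[OF T, of x] n by (simp add: X_eq)
  have "positive_op X"
    unfolding positive_op_iff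
  proof (intro conjI allI X)
    fix x
    have "Re (cinner (T x) x) \<le> norm (T x) * norm x"
      by (rule Re_cinner_le)
    also have "\<dots> \<le> n * norm x * norm x"
      unfolding n_def by (intro mult_right_mono norm_blinfun) auto
    finally show "0 \<le> Re (cinner (X x) x)"
      using n by (simp add: X_eq power2_eq_square field_simps)
  qed
  have "norm (X x) \<le> 1 * norm x" for x
  proof -
    have "((norm (X x))\<^sup>2)\<^sup>2 \<le> Re (cinner (X x) x) * Re (cinner (X (X x)) (X x))"
      using positive_op_Cauchy_Schwarz[OF \<open>positive_op X\<close>, of x "X x"]
      by (simp add: cinner_self norm_power)
    also have "\<dots> \<le> (norm x)\<^sup>2 * (norm (X x))\<^sup>2"
      by (intro mult_mono X_le positive_opD(3)[OF \<open>positive_op X\<close>]) auto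
    finally have "((norm (X x))\<^sup>2)\<^sup>2 \<le> (norm x * norm (X x))\<^sup>2"
      by (simp only: power_mult_distrib)
    then have "(norm (X x))\<^sup>2 \<le> norm x * norm (X x)"
      by (rule power2_le_imp_le) simp
    then show ?thesis
      by (cases "X x = 0") (auto simp: power2_eq_square)
  qed
  then have "norm X \<le> 1"
    by (intro norm_blinfun_bound) auto
  then obtain P where P: "positive_op P" "P o\<^sub>L P = (1 / n) *\<^sub>R T"
    using positive_op_sqrt_exists_contraction[OF X] by (auto simp: X_def)
  show ?thesis
  proof (rule that[of "sqrt n *\<^sub>R P"])
    show "(sqrt n *\<^sub>R P) o\<^sub>L (sqrt n *\<^sub>R P) = T"
      using n P(2) by (simp add: blinfun_compose_scaleR_left blinfun_compose_scaleR_right)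
  qed (use P(1) n in \<open>auto intro: positive_op_scaleR\<close>)
qed

text \<open>With the adjoint S at hand, S T is positive and has a root P, which must be
  \<open>abs_op T\<close>; then |P x|^2 = <S T x, x> = |T x|^2. In this way norm bounds on T carry
  over to its absolute value.\<close>

lemma abs_op_properties:
  fixes T :: "'a::complex_hilbert_space \<Rightarrow>\<^sub>L 'a"
  assumes T: "T \<in> bounded_operators" and S: "S \<in> bounded_operators" "adjoint_pair T S"
  shows positive_abs_op: "positive_op (abs_op T)"
    and norm_abs_op: "norm (blinfun_apply (abs_op T) x) = norm (blinfun_apply T x)"
proof -
  have ST: "adjoint_pair S T"
    using S(2) by (metis adjoint_pair_def cinner_commute)
  have "positive_op (S o\<^sub>L T)"
    unfolding positive_op_iff using T S ST
    by (auto intro!: bounded_operators_intros adjoint_pair_intros simp: adjoint_pairD[OF ST] cinner_self)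
  then obtain P where P: "positive_op P" "P o\<^sub>L P = S o\<^sub>L T"
    by (rule positive_op_sqrt_exists)
  then have abs: "abs_op T = P"
    unfolding abs_op_def adjoint_op_eqI[OF S] by (intro sqrt_op_eqI) 
  with P show "positive_op (abs_op T)"
    by simp
  have "(norm (P x))\<^sup>2 = (norm (T x))\<^sup>2"
    using selfadjoint_compose_self[OF positive_opD(2)[OF P(1)], of x] P(2) adjoint_pairD[OF ST]
    by (simp add: cinner_self)
  then show "norm (abs_op T x) = norm (T x)"
    by (simp add: abs)
qed

subsection \<open>Orthonormal bases\<close>

lemma orthonormal_basisD:
  assumes "orthonormal_basis E" "x \<in> E" "y \<in> E"
  shows "cinner x y = (if x = y then 1 else 0)"
  using assms by (simp add: orthonormal_basis_def)

text \<open>Completing the square in each coefficient. Arbitrary coefficients are allowed so that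
  one identity yields Bessel's inequality (c e = <x, e>) as well as best approximation.\<close>

lemma orthonormal_projection:
  fixes x :: "'a::complex_hilbert_space"
  assumes E: "orthonormal_basis E" and F: "finite F" "F \<subseteq> E"
  shows "(norm (x - (\<Sum>e\<in>F. c e *\<^sub>C e)))\<^sup>2
    = (norm x)\<^sup>2 - (\<Sum>e\<in>F. (cmod (cinner x e))\<^sup>2) + (\<Sum>e\<in>F. (cmod (c e - cinner x e))\<^sup>2)"
proof -
  define y where "y = (\<Sum>e\<in>F. c e *\<^sub>C e)"
  have xy: "cinner x y = (\<Sum>e\<in>F. cnj (c e) * cinner x e)"
    by (simp add: y_def cinner_sum_right cinner_scaleC_right)
  have ye: "cinner y e = c e" if "e \<in> F" for e
  proof -
    have "cinner y e = (\<Sum>f\<in>F. if f = e then c f else 0)"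
      unfolding y_def cinner_sum_left cinner_scaleC_left
      using F that by (intro sum.cong) (auto simp: orthonormal_basisD[OF E] subsetD[OF F(2)])
    then show ?thesis
      using F(1) that by simp
  qed
  have yy: "cinner y y = (\<Sum>e\<in>F. cnj (c e) * c e)"
    using ye by (subst (2) y_def) (simp add: cinner_sum_right cinner_scaleC_right)
  have "(norm (x - y))\<^sup>2 = Re (cinner (x - y) (x - y))"
    by (simp add: cinner_self)
  also have "\<dots> = (norm x)\<^sup>2 - 2 * Re (cinner x y) + Re (cinner y y)"
    using Re_cinner_commute[of x y]
    by (simp add: cinner_diff_left cinner_diff_right cinner_self[of x])
  also have "\<dots> = (norm x)\<^sup>2 + (\<Sum>e\<in>F. Re (cnj (c e) * c e) - 2 * Re (cnj (c e) * cinner x e))"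
    unfolding xy yy by (simp add: sum_subtractf sum_distrib_left)
  also have "(\<Sum>e\<in>F. Re (cnj (c e) * c e) - 2 * Re (cnj (c e) * cinner x e))
      = (\<Sum>e\<in>F. (cmod (c e - cinner x e))\<^sup>2 - (cmod (cinner x e))\<^sup>2)"
    by (intro sum.cong refl) (simp add: cmod_power2, simp add: power2_eq_square algebra_simps)
  finally show ?thesis
    by (simp add: sum_subtractf y_def)
qed

lemma Bessel_inequality:
  fixes x :: "'a::complex_hilbert_space"
  assumes "orthonormal_basis E" "finite F" "F \<subseteq> E"
  shows "(\<Sum>e\<in>F. (cmod (cinner x e))\<^sup>2) \<le> (norm x)\<^sup>2"
  using orthonormal_projection[OF assms, of x "cinner x"]
    zero_le_power2[of "norm (x - (\<Sum>e\<in>F. cinner x e *\<^sub>C e))"] by simp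

lemma orthonormal_best_approximation:
  fixes x :: "'a::complex_hilbert_space"
  assumes "orthonormal_basis E" "finite F" "F \<subseteq> E"
  shows "(norm x)\<^sup>2 - (\<Sum>e\<in>F. (cmod (cinner x e))\<^sup>2) \<le> (norm (x - (\<Sum>e\<in>F. c e *\<^sub>C e)))\<^sup>2"
  using orthonormal_projection[OF assms, of x c] by (simp add: sum_nonneg)

text \<open>Bessel's inequality is one half. For the other, a basis only guarantees approximants of
  x in the span with unknown coefficients; replacing these by the inner products <x, e> does not
  increase the error.\<close>

lemma Parseval:
  fixes x :: "'a::complex_hilbert_space"
  assumes E: "orthonormal_basis E"
  shows "((\<lambda>e. (cmod (cinner x e))\<^sup>2) has_sum (norm x)\<^sup>2) E"
proof -
  let ?f = "\<lambda>e. (cmod (cinner x e))\<^sup>2"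
  have summable: "?f summable_on E"
    by (rule nonneg_bounded_partial_sums_imp_summable_on[where C = "(norm x)\<^sup>2"])
      (auto intro!: eventually_finite_subsets_at_top_weakI Bessel_inequality[OF E])
  have "infsum ?f E \<le> (norm x)\<^sup>2"
    using summable Bessel_inequality[OF E] by (intro infsum_le_finite_sums) auto
  moreover have "(norm x)\<^sup>2 \<le> infsum ?f E"
  proof (rule field_le_epsilon)
    fix \<epsilon> :: real assume "\<epsilon> > 0"
    have "x \<in> closure (complex_vector.span E)"
      using E by (simp add: orthonormal_basis_def)
    then obtain y where y: "y \<in> complex_vector.span E" "dist y x < sqrt \<epsilon>"
      using \<open>\<epsilon> > 0\<close> by (meson closure_approachable real_sqrt_gt_zero)
    then obtain F c where F: "finite F" "F \<subseteq> E" and yF: "y = (\<Sum>e\<in>F. c e *\<^sub>C e)"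
      unfolding complex_vector.span_explicit by auto
    have "(norm x)\<^sup>2 - (\<Sum>e\<in>F. ?f e) \<le> (norm (x - y))\<^sup>2"
      unfolding yF by (rule orthonormal_best_approximation[OF E F])
    also have "\<dots> \<le> (sqrt \<epsilon>)\<^sup>2"
      using y(2) by (intro power_mono) (auto simp: dist_norm norm_minus_commute)
    also have "\<dots> = \<epsilon>"
      using \<open>\<epsilon> > 0\<close> by simp
    finally have "(norm x)\<^sup>2 - (\<Sum>e\<in>F. ?f e) \<le> \<epsilon>" .
    moreover have "(\<Sum>e\<in>F. ?f e) \<le> infsum ?f E"
      by (rule finite_sum_le_infsum[OF summable F]) auto
    ultimately show "(norm x)\<^sup>2 \<le> infsum ?f E + \<epsilon>"
      by simp
  qed
  ultimately show ?thesis
    using summable has_sum_infsum by fastforce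
qed

text \<open>For a finite basis Parseval makes the projection error vanish, so the basis would span
  the whole space.\<close>

lemma infinite_orthonormal_basis:
  fixes E :: "'a::complex_hilbert_space set"
  assumes E: "orthonormal_basis E" and "\<nexists>S :: 'a set. finite S \<and> complex_vector.span S = UNIV"
  shows "infinite E"
proof
  assume fin: "finite E"
  have "x \<in> complex_vector.span E" for x
  proof -
    have "(norm x)\<^sup>2 = (\<Sum>e\<in>E. (cmod (cinner x e))\<^sup>2)"
      using Parseval[OF E, of x] fin by (metis has_sum_finite has_sum_unique)
    then have "x = (\<Sum>e\<in>E. cinner x e *\<^sub>C e)"
      using orthonormal_projection[OF E fin, of x "cinner x"] by simp
    then show ?thesis
      by (metis (no_types, lifting) complex_vector.span_base complex_vector.span_scale complex_vector.span_sum)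
  qed
  then show False
    using assms(2) fin by blast
qed

section \<open>Hilbert-Schmidt sums of self-adjoint operators\<close>

lemma has_sum_sum:
  fixes f :: "'i \<Rightarrow> 'b \<Rightarrow> 'c::{topological_comm_monoid_add}"
  assumes "\<And>i. i \<in> I \<Longrightarrow> (f i has_sum s i) E"
  shows "((\<lambda>e. \<Sum>i\<in>I. f i e) has_sum (\<Sum>i\<in>I. s i)) E"
  using assms by (induction I rule: infinite_finite_induct) (auto intro: has_sum_add has_sum_0)

text \<open>Each |C f|^2 is expanded along E by Parseval; by symmetry the double sum is regrouped
  over e, where Bessel's inequality bounds it by |C e|^2. This links the basis that witnesses
  \<open>trace_class\<close> to the one chosen in \<open>op_trace\<close>.\<close>

lemma summable_on_norm_square_basis_change:
  fixes C :: "'a::complex_hilbert_space \<Rightarrow>\<^sub>L 'a"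
  assumes C: "adjoint_pair C C" and E: "orthonormal_basis E" and E': "orthonormal_basis E'"
    and summable: "(\<lambda>e. (norm (blinfun_apply C e))\<^sup>2) summable_on E"
  shows "(\<lambda>e. (norm (blinfun_apply C e))\<^sup>2) summable_on E'"
proof (rule nonneg_bounded_partial_sums_imp_summable_on)
  show "\<forall>\<^sub>F F in finite_subsets_at_top E'.
    (\<Sum>f\<in>F. (norm (C f))\<^sup>2) \<le> (\<Sum>\<^sub>\<infinity>e\<in>E. (norm (C e))\<^sup>2)"
  proof (rule eventually_finite_subsets_at_top_weakI)
    fix F assume F: "finite F" "F \<subseteq> E'"
    have comm: "cmod (cinner (C f) e) = cmod (cinner (C e) f)" for e f
      using adjoint_pairD[OF C, of f e] cinner_commute[of f "C e"] by simp
    have "((\<lambda>e. \<Sum>f\<in>F. (cmod (cinner (C f) e))\<^sup>2) has_sum (\<Sum>f\<in>F. (norm (C f))\<^sup>2)) E"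
      by (intro has_sum_sum Parseval[OF E])
    moreover have "(\<Sum>f\<in>F. (cmod (cinner (C f) e))\<^sup>2) \<le> (norm (C e))\<^sup>2" for e
      using Bessel_inequality[OF E' F, of "C e"] by (simp only: comm[where e = e])
    ultimately show "(\<Sum>f\<in>F. (norm (C f))\<^sup>2) \<le> (\<Sum>\<^sub>\<infinity>e\<in>E. (norm (C e))\<^sup>2)"
      using has_sum_mono[OF _ has_sum_infsum[OF summable]] by blast
  qed
qed auto

text \<open>The operator norm is at most the Hilbert-Schmidt norm: |<C x, e>| = |<x, C e>| <= |x| |C
  e|, and Parseval sums the squares.\<close>

lemma norm_square_le_infsum:
  fixes C :: "'a::complex_hilbert_space \<Rightarrow>\<^sub>L 'a"
  assumes C: "adjoint_pair C C" and E: "orthonormal_basis E"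
    and summable: "(\<lambda>e. (norm (blinfun_apply C e))\<^sup>2) summable_on E"
  shows "(norm C)\<^sup>2 \<le> (\<Sum>\<^sub>\<infinity>e\<in>E. (norm (blinfun_apply C e))\<^sup>2)"
proof -
  let ?s = "\<Sum>\<^sub>\<infinity>e\<in>E. (norm (C e))\<^sup>2"
  have s: "?s \<ge> 0"
    by (rule infsum_nonneg) auto
  have "norm (C x) \<le> sqrt ?s * norm x" for x
  proof -
    have "(norm (C x))\<^sup>2 \<le> (norm x)\<^sup>2 * ?s"
    proof (rule has_sum_mono[OF Parseval[OF E]])
      show "((\<lambda>e. (norm x)\<^sup>2 * (norm (C e))\<^sup>2) has_sum (norm x)\<^sup>2 * ?s) E"
        by (intro has_sum_cmult_right has_sum_infsum summable)
      show "(cmod (cinner (C x) e))\<^sup>2 \<le> (norm x)\<^sup>2 * (norm (C e))\<^sup>2" for e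
        using cinner_Cauchy_Schwarz[of x "C e"]
        by (simp add: adjoint_pairD[OF C] power_mono flip: power_mult_distrib)
    qed
    then have "norm (C x) \<le> sqrt ((norm x)\<^sup>2 * ?s)"
      by (rule real_le_rsqrt)
    then show ?thesis
      by (simp add: real_sqrt_mult mult.commute)
  qed
  then have "norm C \<le> sqrt ?s"
    by (intro norm_blinfun_bound) (use s in auto)
  then have "(norm C)\<^sup>2 \<le> (sqrt ?s)\<^sup>2"
    by (intro power_mono) auto
  with s show ?thesis
    by simp
qed

subsection \<open>Power series of operators\<close>

lemma norm_scaleC_op_le: "norm (scaleC_op c T) \<le> cmod c * norm T"
proof (rule norm_blinfun_bound)
  show "norm (scaleC_op c T x) \<le> cmod c * norm T * norm x" for x
    using norm_blinfun[of T x] by (simp add: blinfun_apply_scaleC_op norm_scaleC mult.assoc mult_left_mono)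
qed simp

lemma bounded_operators_scaleC_op:
  "T \<in> bounded_operators \<Longrightarrow> scaleC_op c T \<in> bounded_operators"
  by (simp add: bounded_operators_def blinfun_apply_scaleC_op scaleC_scaleC mult.commute)

lemma adjoint_pair_scaleC_op:
  "adjoint_pair S T \<Longrightarrow> adjoint_pair (scaleC_op c S) (scaleC_op (cnj c) T)"
  by (simp add: adjoint_pair_def blinfun_apply_scaleC_op cinner_scaleC_left cinner_scaleC_right)

lemma op_power_0: "op_power S 0 = id_blinfun"
  by (simp add: op_power_def)

lemma op_power_Suc: "op_power S (Suc n) = S o\<^sub>L op_power S n"
  by (simp add: op_power_def)

lemma op_power_Suc_right: "op_power S (Suc n) = op_power S n o\<^sub>L S"
  by (induction n) (simp_all add: op_power_0 op_power_Suc flip: blinfun_compose_assoc)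

lemma norm_op_power_le: "norm (op_power S n) \<le> norm S ^ n"
proof (induction n)
  case (Suc n)
  have "norm (S o\<^sub>L op_power S n) \<le> norm S * norm (op_power S n)"
    by (rule norm_blinfun_compose)
  also have "\<dots> \<le> norm S * norm S ^ n"
    by (intro mult_left_mono Suc) auto
  finally show ?case
    by (simp add: op_power_Suc)
qed (simp add: op_power_0 norm_blinfun_id_le)

lemma bounded_operators_op_power:
  "S \<in> bounded_operators \<Longrightarrow> op_power S n \<in> bounded_operators"
  by (induction n) (auto simp: op_power_0 op_power_Suc intro: bounded_operators_intros)

lemma adjoint_pair_op_power:
  assumes "adjoint_pair S T"
  shows "adjoint_pair (op_power S n) (op_power T n)"
proof (induction n)
  case (Suc n)
  then show ?case
    unfolding op_power_Suc[of S] op_power_Suc_right[of T] using assms by (intro adjoint_pair_intros)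
qed (simp add: op_power_0 adjoint_pair_id)

lemma summable_op_series:
  fixes S :: "'a::complex_hilbert_space \<Rightarrow>\<^sub>L 'a"
  assumes "summable (\<lambda>n. cmod (\<alpha> n) * r ^ n)" "norm S \<le> r"
  shows "summable (\<lambda>n. scaleC_op (\<alpha> n) (op_power S n))"
proof (rule summable_comparison_test'[OF assms(1)])
  fix n
  have "norm (scaleC_op (\<alpha> n) (op_power S n)) \<le> cmod (\<alpha> n) * norm (op_power S n)"
    by (rule norm_scaleC_op_le)
  also have "\<dots> \<le> cmod (\<alpha> n) * r ^ n"
    using norm_op_power_le[of S n] power_mono[OF assms(2), of n]
    by (intro mult_left_mono) auto
  finally show "norm (scaleC_op (\<alpha> n) (op_power S n)) \<le> cmod (\<alpha> n) * r ^ n" .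
qed

lemma op_series_LIMSEQ:
  assumes "summable (\<lambda>n. scaleC_op (\<alpha> n) (op_power S n))"
  shows "(\<lambda>n. \<Sum>k<n. scaleC_op (\<alpha> k) (op_power S k)) \<longlonglongrightarrow> op_series \<alpha> S"
  unfolding op_series_def using assms by (rule summable_LIMSEQ)

lemma bounded_operators_op_series:
  assumes "summable (\<lambda>n. scaleC_op (\<alpha> n) (op_power S n))" "S \<in> bounded_operators"
  shows "op_series \<alpha> S \<in> bounded_operators"
proof (rule bounded_operators_limit[OF _ op_series_LIMSEQ[OF assms(1)]])
  show "(\<Sum>k<n. scaleC_op (\<alpha> k) (op_power S k)) \<in> bounded_operators" for n
  proof (induction n)
    case 0
    then show ?case
      by (simp add: bounded_operators_def)
  qed (auto intro!: bounded_operators_intros bounded_operators_scaleC_op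
      bounded_operators_op_power assms(2))
qed

text \<open>Applied to S = AB and T = BA, this exhibits the adjoint of f(AB), which the absolute
  value of f(AB) requires.\<close>

lemma adjoint_pair_op_series:
  assumes "summable (\<lambda>n. scaleC_op (\<alpha> n) (op_power S n))"
    and "summable (\<lambda>n. scaleC_op (cnj (\<alpha> n)) (op_power T n))"
    and "adjoint_pair S T"
  shows "adjoint_pair (op_series \<alpha> S) (op_series (\<lambda>n. cnj (\<alpha> n)) T)"
proof (rule adjoint_pair_limit[OF _ op_series_LIMSEQ[OF assms(1)] op_series_LIMSEQ[OF assms(2)]])
  show "adjoint_pair (\<Sum>k<n. scaleC_op (\<alpha> k) (op_power S k))
      (\<Sum>k<n. scaleC_op (cnj (\<alpha> k)) (op_power T k))" for n
  proof (induction n)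
    case 0
    then show ?case
      by (simp add: adjoint_pair_def)
  qed (auto intro!: adjoint_pair_intros adjoint_pair_scaleC_op adjoint_pair_op_power assms(3))
qed

text \<open>The identity term is split off because only the positive powers of AB contain the
  factors that make their diagonals summable.\<close>

lemma op_series_tail_sums:
  assumes "summable (\<lambda>n. scaleC_op (\<alpha> n) (op_power S n))"
  shows "(\<lambda>n. \<alpha> (Suc n) *\<^sub>C blinfun_apply (op_power S (Suc n)) x) sums
    (blinfun_apply (op_series \<alpha> S) x - \<alpha> 0 *\<^sub>C x)"
proof -
  have "(\<lambda>n. scaleC_op (\<alpha> n) (op_power S n)) sums op_series \<alpha> S"
    unfolding op_series_def using assms by (rule summable_sums)
  then have "(\<lambda>n. scaleC_op (\<alpha> n) (op_power S n) x) sums op_series \<alpha> S x"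
    by (rule bounded_linear.sums[OF blinfun.bounded_linear_left])
  then show ?thesis
    by (subst sums_Suc_iff) (simp add: blinfun_apply_scaleC_op op_power_0)
qed

subsection \<open>Positive trace class operators\<close>

text \<open>The basis hidden in \<open>op_trace\<close>. That it is a basis follows only once some
  basis exists, which membership in \<open>trace_class\<close> supplies.\<close>

definition trace_basis :: "'a::complex_hilbert_space set" where
  "trace_basis = (SOME E. orthonormal_basis E)"

text \<open>For the positive root C one has <A e, e> = |C e|^2, so the trace of A is the squared
  Hilbert-Schmidt norm of C, in whichever basis \<open>op_trace\<close> selects.\<close>

lemma trace_class_sqrt:
  fixes A :: "'a::complex_hilbert_space \<Rightarrow>\<^sub>L 'a"
  assumes "A \<in> trace_class" and A: "positive_op A"
  obtains C where "positive_op C" "C o\<^sub>L C = A" "orthonormal_basis (trace_basis :: 'a set)"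
    "((\<lambda>e. (norm (blinfun_apply C e))\<^sup>2) has_sum Re (op_trace A)) trace_basis"
proof -
  obtain C where C: "positive_op C" "C o\<^sub>L C = A"
    using positive_op_sqrt_exists[OF A] .
  have eq: "cinner (A e) e = of_real ((norm (C e))\<^sup>2)" for e
    using adjoint_pairD[OF positive_opD(2)[OF C(1)], of "C e" e] C(2)
    by (auto simp: cinner_self)
  obtain E where E: "orthonormal_basis E" and "(\<lambda>e. cinner (A e) e) summable_on E"
    using assms(1) abs_op_positive[OF A] by (auto simp: trace_class_def)
  then have "(\<lambda>e. (norm (C e))\<^sup>2) summable_on E"
    using summable_on_Re by (fastforce simp: eq)
  moreover have basis: "orthonormal_basis (trace_basis :: 'a set)"
    unfolding trace_basis_def using E by (rule someI)
  ultimately have summable: "(\<lambda>e. (norm (C e))\<^sup>2) summable_on trace_basis"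
    using summable_on_norm_square_basis_change[OF positive_opD(2)[OF C(1)] E] by blast
  have "op_trace A = of_real (\<Sum>\<^sub>\<infinity>e\<in>trace_basis. (norm (C e))\<^sup>2)"
    unfolding op_trace_def eq trace_basis_def[symmetric]
    by (intro infsumI has_sum_of_real has_sum_infsum summable)
  then have "((\<lambda>e. (norm (C e))\<^sup>2) has_sum Re (op_trace A)) trace_basis"
    using has_sum_infsum[OF summable] by simp
  with C basis show ?thesis
    using that by blast
qed

section \<open>Estimates for the operator and scalar series\<close>

lemma Cauchy_Schwarz_has_sum:
  fixes f g :: "'b \<Rightarrow> real"
  assumes f: "((\<lambda>e. (f e)\<^sup>2) has_sum a) E" and g: "((\<lambda>e. (g e)\<^sup>2) has_sum b) E"
    and nonneg: "\<And>e. 0 \<le> f e" "\<And>e. 0 \<le> g e"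
  shows "(\<lambda>e. f e * g e) summable_on E" "(\<Sum>\<^sub>\<infinity>e\<in>E. f e * g e) \<le> sqrt a * sqrt b"
proof -
  have le: "(\<Sum>e\<in>F. f e * g e) \<le> sqrt a * sqrt b" if F: "finite F" "F \<subseteq> E" for F
  proof -
    have "(\<Sum>e\<in>F. f e * g e) \<le> L2_set f F * L2_set g F"
      using L2_set_mult_ineq[where f = f and g = g] nonneg by simp
    also have "\<dots> \<le> sqrt a * sqrt b"
      unfolding L2_set_def
      using finite_sum_le_has_sum[OF f F] finite_sum_le_has_sum[OF g F] has_sum_nonneg[OF f]
      by (intro mult_mono real_sqrt_le_mono) (simp_all add: sum_nonneg)
    finally show ?thesis .
  qed
  show summable: "(\<lambda>e. f e * g e) summable_on E"
    by (rule nonneg_bounded_partial_sums_imp_summable_on[where C = "sqrt a * sqrt b"])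
      (auto intro!: eventually_finite_subsets_at_top_weakI le simp: nonneg)
  show "(\<Sum>\<^sub>\<infinity>e\<in>E. f e * g e) \<le> sqrt a * sqrt b"
    using summable le by (rule infsum_le_finite_sums)
qed

text \<open>The outer C and D are kept apart for the sum over a basis. V starts as C D, and one more
  factor AB turns V into C D D C V, which costs |C|^2 |D|^2 in norm.\<close>

lemma op_power_product_factorization:
  fixes C D :: "'a::complex_hilbert_space \<Rightarrow>\<^sub>L 'a"
  shows "\<exists>V. op_power ((C o\<^sub>L C) o\<^sub>L (D o\<^sub>L D)) (Suc n) = C o\<^sub>L (V o\<^sub>L D) \<and>
    norm V \<le> norm C * norm D * ((norm C)\<^sup>2 * (norm D)\<^sup>2) ^ n"
proof (induction n)
  case 0
  show ?case
    by (rule exI[of _ "C o\<^sub>L D"])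
      (simp add: op_power_Suc op_power_0 blinfun_compose_assoc norm_blinfun_compose)
next
  case (Suc n)
  then obtain V where V: "op_power ((C o\<^sub>L C) o\<^sub>L (D o\<^sub>L D)) (Suc n) = C o\<^sub>L (V o\<^sub>L D)"
    "norm V \<le> norm C * norm D * ((norm C)\<^sup>2 * (norm D)\<^sup>2) ^ n"
    by blast
  let ?W = "C o\<^sub>L (D o\<^sub>L (D o\<^sub>L (C o\<^sub>L V)))"
  have "norm ?W \<le> norm C * (norm D * (norm D * (norm C * norm V)))"
    by (intro order_trans[OF norm_blinfun_compose] mult_left_mono norm_blinfun_compose norm_ge_zero)
  also have "\<dots> \<le> norm C * (norm D * (norm D * (norm C * (norm C * norm D * ((norm C)\<^sup>2 * (norm D)\<^sup>2) ^ n))))"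
    by (intro mult_left_mono V) auto
  also have "\<dots> = norm C * norm D * ((norm C)\<^sup>2 * (norm D)\<^sup>2) ^ Suc n"
    by (simp add: power2_eq_square mult_ac)
  finally show ?case
    by (intro exI[of _ ?W] conjI, subst op_power_Suc, subst V(1)) (simp add: blinfun_compose_assoc)
qed

text \<open>The weight is split evenly, |alpha_k| (a b)^k = (sqrt |alpha_k| a^k) (sqrt |alpha_k|
  b^k); the finite inequality for the partial sums passes to the limit.\<close>

lemma Cauchy_Schwarz_abs_series:
  assumes a: "summable (\<lambda>n. cmod (\<alpha> n) * (a\<^sup>2) ^ n)" and b: "summable (\<lambda>n. cmod (\<alpha> n) * (b\<^sup>2) ^ n)"
    and ab: "summable (\<lambda>n. cmod (\<alpha> n) * (a * b) ^ n)"
  shows "(abs_series \<alpha> (a * b))\<^sup>2 \<le> abs_series \<alpha> (a\<^sup>2) * abs_series \<alpha> (b\<^sup>2)"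
proof (rule LIMSEQ_le)
  show "(\<lambda>n. (\<Sum>k<n. cmod (\<alpha> k) * (a * b) ^ k)\<^sup>2) \<longlonglongrightarrow> (abs_series \<alpha> (a * b))\<^sup>2"
    unfolding abs_series_def by (intro tendsto_intros summable_LIMSEQ ab)
  show "(\<lambda>n. (\<Sum>k<n. cmod (\<alpha> k) * (a\<^sup>2) ^ k) * (\<Sum>k<n. cmod (\<alpha> k) * (b\<^sup>2) ^ k))
      \<longlonglongrightarrow> abs_series \<alpha> (a\<^sup>2) * abs_series \<alpha> (b\<^sup>2)"
    unfolding abs_series_def by (intro tendsto_intros summable_LIMSEQ a b)
  have "(\<Sum>k<n. cmod (\<alpha> k) * (a * b) ^ k)\<^sup>2
      \<le> (\<Sum>k<n. cmod (\<alpha> k) * (a\<^sup>2) ^ k) * (\<Sum>k<n. cmod (\<alpha> k) * (b\<^sup>2) ^ k)" for n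
  proof -
    have "(\<Sum>k<n. (sqrt (cmod (\<alpha> k)) * a ^ k) * (sqrt (cmod (\<alpha> k)) * b ^ k))\<^sup>2
      \<le> (\<Sum>k<n. (sqrt (cmod (\<alpha> k)) * a ^ k)\<^sup>2) * (\<Sum>k<n. (sqrt (cmod (\<alpha> k)) * b ^ k)\<^sup>2)"
      by (rule Cauchy_Schwarz_ineq_sum)
    moreover have "(sqrt (cmod (\<alpha> k)) * x ^ k) * (sqrt (cmod (\<alpha> k)) * y ^ k)
        = cmod (\<alpha> k) * (x * y) ^ k" for k x y
    proof -
      have "(sqrt (cmod (\<alpha> k)) * x ^ k) * (sqrt (cmod (\<alpha> k)) * y ^ k)
          = (sqrt (cmod (\<alpha> k)) * sqrt (cmod (\<alpha> k))) * (x ^ k * y ^ k)"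
        by (simp only: mult_ac)
      then show ?thesis
        by (simp add: power_mult_distrib)
    qed
    ultimately show ?thesis
      by (simp add: power2_eq_square[of "_ * _"] power2_eq_square[of a] power2_eq_square[of b])
  qed
  then show "\<exists>N. \<forall>n\<ge>N. (\<Sum>k<n. cmod (\<alpha> k) * (a * b) ^ k)\<^sup>2
      \<le> (\<Sum>k<n. cmod (\<alpha> k) * (a\<^sup>2) ^ k) * (\<Sum>k<n. cmod (\<alpha> k) * (b\<^sup>2) ^ k)"
    by blast
qed

lemma ereal_mult_less_of_less_sqrt:
  assumes "R > 0" "0 \<le> a" "0 \<le> b" "ereal a < ereal_sqrt R" "ereal b < ereal_sqrt R"
  shows "ereal (a * b) < R"
proof (cases R)
  case (real r)
  then have "a * b < sqrt r * sqrt r"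
    using assms by (intro mult_strict_mono') (auto simp: ereal_sqrt_def)
  then show ?thesis
    using real assms(1) by simp
qed (use assms in auto)

text \<open>Strictness leaves a radius r between x and R; convergence at r implies absolute
  convergence at x.\<close>

lemma summable_abs_series:
  fixes \<alpha> :: "nat \<Rightarrow> complex"
  assumes conv: "\<And>z. ereal (cmod z) < R \<Longrightarrow> summable (\<lambda>n. \<alpha> n * z ^ n)"
    and x: "0 \<le> x" "ereal x < R"
  shows "summable (\<lambda>n. cmod (\<alpha> n) * x ^ n)"
proof -
  obtain r where r: "x < r" "ereal r < R"
    using ereal_dense2[OF x(2)] by auto
  then have "summable (\<lambda>n. \<alpha> n * of_real r ^ n)"
    using x(1) by (intro conv) auto
  from powser_insidea[OF this, of "of_real x"] show ?thesis
    using r x(1) by (simp add: norm_mult norm_power)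
qed

(* With C and D the square roots of A and B, every positive power of AB has the form C V D,
   so the diagonal entries of f(AB) - \<alpha>_0 are dominated by |C e| |D e|. *)
lemma op_series_product_diagonal:
  fixes A B C D :: "'a::complex_hilbert_space \<Rightarrow>\<^sub>L 'a"
  assumes C: "adjoint_pair C C" "C o\<^sub>L C = A" "(norm C)\<^sup>2 \<le> a"
    and D: "adjoint_pair D D" "D o\<^sub>L D = B" "(norm D)\<^sup>2 \<le> b"
    and summable: "summable (\<lambda>n. scaleC_op (\<alpha> n) (op_power (A o\<^sub>L B) n))"
      "summable (\<lambda>n. cmod (\<alpha> (Suc n)) * (a * b) ^ n)"
  shows "cmod (cinner (blinfun_apply (op_series \<alpha> (A o\<^sub>L B)) e) e - \<alpha> 0 * cinner e e)
    \<le> sqrt a * sqrt b * (\<Sum>n. cmod (\<alpha> (Suc n)) * (a * b) ^ n)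
      * (norm (blinfun_apply C e) * norm (blinfun_apply D e))"
proof -
  have ab: "0 \<le> a" "0 \<le> b"
    using C(3) D(3) zero_le_power2 order_trans by blast+
  have CD: "norm C \<le> sqrt a" "norm D \<le> sqrt b"
    using C(3) D(3) by (auto intro: real_le_rsqrt)
  define k where "k = sqrt a * sqrt b * (norm (C e) * norm (D e))"
  have term_le: "cmod (\<alpha> (Suc n) * cinner (op_power (A o\<^sub>L B) (Suc n) e) e)
      \<le> k * (cmod (\<alpha> (Suc n)) * (a * b) ^ n)" for n
  proof -
    obtain V where V: "op_power (A o\<^sub>L B) (Suc n) = C o\<^sub>L (V o\<^sub>L D)"
      "norm V \<le> norm C * norm D * ((norm C)\<^sup>2 * (norm D)\<^sup>2) ^ n"
      using op_power_product_factorization[of C D n] C(2) D(2) by auto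
    note V(2)
    also have "norm C * norm D * ((norm C)\<^sup>2 * (norm D)\<^sup>2) ^ n \<le> sqrt a * sqrt b * (a * b) ^ n"
      using ab CD C(3) D(3) by (intro mult_mono power_mono) auto
    finally have V': "norm V \<le> sqrt a * sqrt b * (a * b) ^ n" .
    have "cmod (cinner (op_power (A o\<^sub>L B) (Suc n) e) e) = cmod (cinner (V (D e)) (C e))"
      by (simp add: V(1) adjoint_pairD[OF C(1)])
    also have "\<dots> \<le> norm (V (D e)) * norm (C e)"
      by (rule cinner_Cauchy_Schwarz)
    also have "\<dots> \<le> sqrt a * sqrt b * (a * b) ^ n * norm (D e) * norm (C e)"
      by (intro mult_right_mono order_trans[OF norm_blinfun] V') auto
    also have "\<dots> = k * (a * b) ^ n"
      by (simp add: k_def mult_ac)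
    finally show ?thesis
      by (simp add: norm_mult mult.left_commute[of k] mult_left_mono)
  qed
  have "(\<lambda>n. \<alpha> (Suc n) * cinner (op_power (A o\<^sub>L B) (Suc n) e) e) sums
      (cinner (op_series \<alpha> (A o\<^sub>L B) e) e - \<alpha> 0 * cinner e e)"
    using bounded_linear.sums[OF bounded_linear_cinner_left op_series_tail_sums[OF summable(1)], of e e]
    by (simp add: cinner_scaleC_left cinner_diff_left)
  then have "cmod (cinner (op_series \<alpha> (A o\<^sub>L B) e) e - \<alpha> 0 * cinner e e)
      \<le> (\<Sum>n. k * (cmod (\<alpha> (Suc n)) * (a * b) ^ n))"
    using norm_suminf_le[OF term_le summable_mult[OF summable(2)]] by (simp add: sums_iff)
  also have "\<dots> = k * (\<Sum>n. cmod (\<alpha> (Suc n)) * (a * b) ^ n)"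
    by (rule suminf_mult[OF summable(2)])
  finally show ?thesis
    by (simp add: k_def mult_ac)
qed

text \<open>For n > 0 the power (AB)^n ends in B on the right, so |B x| factors out of every term;
  \<open>\<alpha> 0 = 0\<close> excludes the identity term, which does not.\<close>

lemma norm_op_series_product_le:
  fixes A B :: "'a::complex_hilbert_space \<Rightarrow>\<^sub>L 'a"
  assumes A: "norm A \<le> a" and B: "norm B \<le> b"
    and "summable (\<lambda>n. scaleC_op (\<alpha> n) (op_power (A o\<^sub>L B) n))"
    and summable: "summable (\<lambda>n. cmod (\<alpha> (Suc n)) * (a * b) ^ n)" and "\<alpha> 0 = 0"
  shows "norm (blinfun_apply (op_series \<alpha> (A o\<^sub>L B)) x)
    \<le> a * (\<Sum>n. cmod (\<alpha> (Suc n)) * (a * b) ^ n) * norm (blinfun_apply B x)"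
proof -
  have ab: "0 \<le> a" "0 \<le> b"
    using A B norm_ge_zero order_trans by blast+
  have term_le: "norm (\<alpha> (Suc n) *\<^sub>C op_power (A o\<^sub>L B) (Suc n) x)
      \<le> a * norm (B x) * (cmod (\<alpha> (Suc n)) * (a * b) ^ n)" for n
  proof -
    have "norm (op_power (A o\<^sub>L B) (Suc n) x) = norm (op_power (A o\<^sub>L B) n (A (B x)))"
      by (simp add: op_power_Suc_right)
    also have "\<dots> \<le> norm (op_power (A o\<^sub>L B) n) * (norm A * norm (B x))"
      by (intro order_trans[OF norm_blinfun] mult_left_mono norm_blinfun) auto
    also have "\<dots> \<le> (a * b) ^ n * (a * norm (B x))"
    proof (intro mult_mono A)
      have "norm (A o\<^sub>L B) \<le> norm A * norm B"
        by (rule norm_blinfun_compose)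
      also have "\<dots> \<le> a * b"
        using A B ab by (intro mult_mono) auto
      finally show "norm (op_power (A o\<^sub>L B) n) \<le> (a * b) ^ n"
        by (intro order_trans[OF norm_op_power_le] power_mono) auto
    qed (use ab in auto)
    also have "\<dots> = a * norm (B x) * (a * b) ^ n"
      by (simp only: mult_ac)
    finally show ?thesis
      by (simp add: norm_scaleC mult.left_commute[of "a * norm (B x)"] mult_left_mono)
  qed
  have "norm (op_series \<alpha> (A o\<^sub>L B) x) \<le> (\<Sum>n. a * norm (B x) * (cmod (\<alpha> (Suc n)) * (a * b) ^ n))"
    using norm_suminf_le[OF term_le summable_mult[OF summable]] op_series_tail_sums[OF assms(3), of x]
    by (simp add: sums_iff \<open>\<alpha> 0 = 0\<close>)
  also have "\<dots> = a * norm (B x) * (\<Sum>n. cmod (\<alpha> (Suc n)) * (a * b) ^ n)"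
    by (rule suminf_mult[OF summable])
  finally show ?thesis
    by (simp add: mult_ac)
qed

text \<open>Otherwise the difference, a nonzero constant, would be summable over an infinite
  set.\<close>

lemma not_summable_on_shifted_constant:
  fixes f :: "'b \<Rightarrow> complex"
  assumes "infinite E" "c \<noteq> 0" "(\<lambda>e. f e - c) summable_on E"
  shows "\<not> f summable_on E"
proof
  assume "f summable_on E"
  then have "(\<lambda>e. f e + - (f e - c)) summable_on E"
    using assms(3) by (intro summable_on_add) (simp_all only: summable_on_uminus)
  \<comment> \<open>Normalizing the constant to 1 allows the passage to real parts without the risk
    that Re c is 0.\<close>
  then have "(\<lambda>e. inverse c * c) summable_on E"
    by (intro summable_on_cmult_right) simp
  then have "(\<lambda>e. Re 1) summable_on E"
    using \<open>c \<noteq> 0\<close> by (intro summable_on_Re) simp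
  then show False
    using infsum_diverge_constant[OF \<open>infinite E\<close>, of "1 :: real"] by simp
qed

text \<open>\<open>trace_class\<close> asks for the diagonal of the absolute value, which a bound on
  the diagonal of T would not control. Comparing norms with k B does control it, and the basis that
  witnesses B serves for T.\<close>

lemma trace_class_of_norm_le:
  fixes T B :: "'a::complex_hilbert_space \<Rightarrow>\<^sub>L 'a"
  assumes T: "T \<in> bounded_operators" and S: "S \<in> bounded_operators" "adjoint_pair T S"
    and B: "B \<in> trace_class" "positive_op B"
    and le: "\<And>x. norm (blinfun_apply T x) \<le> k * norm (blinfun_apply B x)" and "0 \<le> k"
  shows "T \<in> trace_class"
proof -
  obtain E where E: "orthonormal_basis E" "(\<lambda>e. cinner (B e) e) summable_on E"
    using B by (auto simp: trace_class_def abs_op_positive)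
  have pos: "positive_op (abs_op T)"
    by (rule positive_abs_op[OF T S])
  have "Re (cinner (abs_op T x) x) \<le> k * Re (cinner (B x) x)" for x
    using positive_op_le_of_norm_le[OF pos positive_op_scaleR[OF B(2) \<open>0 \<le> k\<close>], of x] le \<open>0 \<le> k\<close>
    by (simp add: norm_abs_op[OF T S] blinfun.scaleR_left cinner_scaleR_left)
  then have "(\<lambda>e. Re (cinner (abs_op T e) e)) summable_on E"
    by (intro summable_on_comparison_test[OF summable_on_cmult_right[OF summable_on_Re[OF E(2)]]]
        positive_opD(3)[OF pos])
  then have "(\<lambda>e. of_real (Re (cinner (abs_op T e) e)) :: complex) summable_on E"
    by (rule summable_on_of_real)
  then have "(\<lambda>e. cinner (abs_op T e) e) summable_on E"
    by (simp flip: positive_op_Re[OF pos])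
  then show ?thesis
    using T E(1) by (auto simp: trace_class_def)
qed

theorem proposition4:
  fixes \<alpha> :: "nat \<Rightarrow> complex" and R :: ereal
    and A B :: "'a::complex_hilbert_space \<Rightarrow>\<^sub>L 'a"
  assumes "R > 0"
    and "\<And>z. ereal (cmod z) < R \<Longrightarrow> summable (\<lambda>n. \<alpha> n * z ^ n)"
    and separable: "\<exists>D :: 'a set. countable D \<and> closure D = UNIV"
    and infinite_dimensional: "\<nexists>S :: 'a set. finite S \<and> complex_vector.span S = UNIV"
    and "A \<in> trace_class" and "positive_op A"
    and "B \<in> trace_class" and "positive_op B"
    and "ereal (Re (op_trace A)) < ereal_sqrt R"
    and "ereal (Re (op_trace B)) < ereal_sqrt R"
  shows "summable (\<lambda>n. scaleC_op (\<alpha> n) (op_power (A o\<^sub>L B) n)) \<and>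
    (\<alpha> 0 = 0 \<longrightarrow> op_series \<alpha> (A o\<^sub>L B) \<in> trace_class) \<and>
    (cmod (op_trace (op_series \<alpha> (A o\<^sub>L B))))\<^sup>2
      \<le> (abs_series \<alpha> (Re (op_trace A) * Re (op_trace B)))\<^sup>2 \<and>
    (abs_series \<alpha> (Re (op_trace A) * Re (op_trace B)))\<^sup>2
      \<le> abs_series \<alpha> ((Re (op_trace A))\<^sup>2) * abs_series \<alpha> ((Re (op_trace B))\<^sup>2)"
proof -
  define a where "a = Re (op_trace A)"
  define b where "b = Re (op_trace B)"
  obtain C where C: "positive_op C" "C o\<^sub>L C = A" and E: "orthonormal_basis (trace_basis :: 'a set)"
    and C_sum: "((\<lambda>e. (norm (C e))\<^sup>2) has_sum a) trace_basis"
    using trace_class_sqrt[OF \<open>A \<in> trace_class\<close> \<open>positive_op A\<close>] unfolding a_def by blast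
  obtain D where D: "positive_op D" "D o\<^sub>L D = B"
    and D_sum: "((\<lambda>e. (norm (D e))\<^sup>2) has_sum b) trace_basis"
    using trace_class_sqrt[OF \<open>B \<in> trace_class\<close> \<open>positive_op B\<close>] unfolding b_def by blast
  have Ca: "(norm C)\<^sup>2 \<le> a"
    using norm_square_le_infsum[OF positive_opD(2)[OF C(1)] E has_sum_imp_summable[OF C_sum]]
    by (simp add: infsumI[OF C_sum])
  have Db: "(norm D)\<^sup>2 \<le> b"
    using norm_square_le_infsum[OF positive_opD(2)[OF D(1)] E has_sum_imp_summable[OF D_sum]]
    by (simp add: infsumI[OF D_sum])
  have ab: "0 \<le> a" "0 \<le> b"
    using Ca Db zero_le_power2 order_trans by blast+
  have Aa: "norm A \<le> a"
    using norm_blinfun_compose[of C C] Ca by (simp add: C(2) power2_eq_square)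
  have Bb: "norm B \<le> b"
    using norm_blinfun_compose[of D D] Db by (simp add: D(2) power2_eq_square)
  \<comment> \<open>Two arguments, because the radii a b, a^2 and b^2 are all required.\<close>
  have summable_abs: "summable (\<lambda>n. cmod (\<alpha> n) * (x * y) ^ n)"
    if "0 \<le> x" "ereal x < ereal_sqrt R" "0 \<le> y" "ereal y < ereal_sqrt R" for x y
    by (rule summable_abs_series[OF assms(2)])
      (use that in \<open>auto intro: ereal_mult_less_of_less_sqrt[OF \<open>R > 0\<close>]\<close>)
  have aR: "ereal a < ereal_sqrt R" and bR: "ereal b < ereal_sqrt R"
    unfolding a_def b_def by (fact assms)+
  have sum_ab: "summable (\<lambda>n. cmod (\<alpha> n) * (a * b) ^ n)"
    by (rule summable_abs[OF ab(1) aR ab(2) bR])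
  then have sum_Suc: "summable (\<lambda>n. cmod (\<alpha> (Suc n)) * (a * b) ^ n)"
    by (subst summable_powser_split_head)
  have norm_AB: "norm (A o\<^sub>L B) \<le> a * b" "norm (B o\<^sub>L A) \<le> a * b"
    using norm_blinfun_compose[of A B] norm_blinfun_compose[of B A] mult_mono[OF Aa Bb ab(1) norm_ge_zero]
    by (simp_all add: mult.commute[of "norm B"])
  have sum_op: "summable (\<lambda>n. scaleC_op (\<alpha> n) (op_power (A o\<^sub>L B) n))"
    by (rule summable_op_series[OF sum_ab norm_AB(1)])
  \<comment> \<open>The conjugate coefficients have the same moduli and BA the same norm bound, so
    the same scalar series dominates.\<close>
  have sum_op': "summable (\<lambda>n. scaleC_op (cnj (\<alpha> n)) (op_power (B o\<^sub>L A) n))"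
    by (rule summable_op_series[OF _ norm_AB(2)]) (use sum_ab in simp)
  define T where "T = op_series \<alpha> (A o\<^sub>L B)"
  define K where "K = (\<Sum>n. cmod (\<alpha> (Suc n)) * (a * b) ^ n)"
  have "0 \<le> K"
    unfolding K_def using ab by (intro suminf_nonneg sum_Suc) auto
  have AB_op: "A o\<^sub>L B \<in> bounded_operators" "B o\<^sub>L A \<in> bounded_operators"
    "adjoint_pair (A o\<^sub>L B) (B o\<^sub>L A)"
    using positive_opD(1,2)[OF \<open>positive_op A\<close>] positive_opD(1,2)[OF \<open>positive_op B\<close>]
    by (simp_all add: bounded_operators_compose adjoint_pair_compose)
  have trace_class: "T \<in> trace_class" if "\<alpha> 0 = 0"
    unfolding T_def
  proof (rule trace_class_of_norm_le)
    show "norm (op_series \<alpha> (A o\<^sub>L B) x) \<le> a * K * norm (B x)" for x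
      unfolding K_def by (rule norm_op_series_product_le[OF Aa Bb sum_op sum_Suc that])
    show "adjoint_pair (op_series \<alpha> (A o\<^sub>L B)) (op_series (\<lambda>n. cnj (\<alpha> n)) (B o\<^sub>L A))"
      by (rule adjoint_pair_op_series[OF sum_op sum_op' AB_op(3)])
  qed (use ab \<open>0 \<le> K\<close> \<open>B \<in> trace_class\<close> \<open>positive_op B\<close> in
      \<open>simp_all add: bounded_operators_op_series sum_op sum_op' AB_op\<close>)
  \<comment> \<open>A summable majorant for the diagonal of T minus alpha_0; it serves both cases
    below.\<close>
  define h where "h = (\<lambda>e. sqrt a * sqrt b * K * (norm (C e) * norm (D e)))"
  note CD = Cauchy_Schwarz_has_sum[OF C_sum D_sum norm_ge_zero norm_ge_zero]
  have h: "h summable_on trace_basis"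
    unfolding h_def by (intro summable_on_cmult_right CD(1))
  have diag: "cmod (cinner (T e) e - \<alpha> 0) \<le> h e" if "e \<in> trace_basis" for e
    using op_series_product_diagonal[OF positive_opD(2)[OF C(1)] C(2) Ca positive_opD(2)[OF D(1)] D(2) Db
        sum_op sum_Suc, of e] orthonormal_basisD[OF E that that]
    by (simp add: T_def h_def K_def)
  have abs_summable: "(\<lambda>e. cmod (cinner (T e) e - \<alpha> 0)) summable_on trace_basis"
    using h diag by (rule Infinite_Sum.abs_summable_on_comparison_test')
  have "cmod (op_trace T) \<le> abs_series \<alpha> (a * b)"
  proof (cases "\<alpha> 0 = 0")
    case True
    have "cmod (op_trace T) \<le> (\<Sum>\<^sub>\<infinity>e\<in>trace_basis. cmod (cinner (T e) e))"
      unfolding op_trace_def trace_basis_def[symmetric]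
      using abs_summable True by (intro norm_infsum_bound) simp
    also have "\<dots> \<le> infsum h trace_basis"
      using abs_summable h diag True by (intro infsum_mono) auto
    also have "\<dots> = sqrt a * sqrt b * K * (\<Sum>\<^sub>\<infinity>e\<in>trace_basis. norm (C e) * norm (D e))"
      unfolding h_def by (rule infsum_cmult_right) (use CD(1) in simp)
    \<comment> \<open>One sqrt (a b) is already present from the norm of V; the second comes from
      the Hilbert-Schmidt norms. Their product a b restores the power by which the tail K is
      shifted.\<close>
    also have "\<dots> \<le> sqrt a * sqrt b * K * (sqrt a * sqrt b)"
      using ab \<open>0 \<le> K\<close> by (intro mult_left_mono CD(2)) auto
    also have "\<dots> = (sqrt a * sqrt a) * (sqrt b * sqrt b) * K"
      by (simp only: mult_ac)
    also have "\<dots> = K * (a * b)"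
      using ab by simp
    also have "\<dots> = abs_series \<alpha> (a * b)"
      unfolding abs_series_def K_def using powser_split_head(2)[OF sum_ab] True by simp
    finally show ?thesis .
  next
    case False
    have "\<not> (\<lambda>e. cinner (T e) e) summable_on trace_basis"
      by (rule not_summable_on_shifted_constant[OF infinite_orthonormal_basis[OF E infinite_dimensional] False
            abs_summable_summable[OF abs_summable]])
    \<comment> \<open>\<open>infsum\<close> defaults to 0 here, so the estimate reduces to
      nonnegativity of \<open>abs_series\<close>.\<close>
    then have "op_trace T = 0"
      unfolding op_trace_def trace_basis_def by (rule infsum_not_exists)
    then show ?thesis
      using ab by (simp add: abs_series_def suminf_nonneg[OF sum_ab])
  qed
  then have "(cmod (op_trace T))\<^sup>2 \<le> (abs_series \<alpha> (a * b))\<^sup>2"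
    by (intro power_mono) auto
  moreover have "(abs_series \<alpha> (a * b))\<^sup>2 \<le> abs_series \<alpha> (a\<^sup>2) * abs_series \<alpha> (b\<^sup>2)"
    using summable_abs[OF ab(1) aR ab(1) aR] summable_abs[OF ab(2) bR ab(2) bR]
    by (intro Cauchy_Schwarz_abs_series[OF _ _ sum_ab]) (simp_all only: power2_eq_square)
  ultimately show ?thesis
    using sum_op trace_class unfolding T_def a_def b_def by blast
qed

end
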